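(* Every $3$-regular graph $G$ having a MED decomposition is $(7,2)$-edge-choosable.
   Context: A double-star is a $6$-vertex tree having two adjacent vertices of degree $3$. A subgraph $F$ of $G$ consists of independent double-stars if its components are pairwise vertex-disjoint double-stars and the set of all leaves of components of $F$ is an independent set of vertices in $G$. A MED decomposition of $G$ is a partition of $E(G)$ into subgraphs $G_1,G_2,G_3$ where $G_1$ is a matching, every component of $G_2$ is an even cycle, and $G_3$ consists of independent double-stars. A graph is $(r,s)$-edge-choosable if for every assignment of lists of size $r$ to its edges, one can choose $s$ colors from each edge's list so that incident edges receive disjoint sets. *)

theory Defs
  imports Main
begin

text \<open>
  A graph is a pair of a vertex set and a set of edges, each edge being the set of its two ends.
  The predicate \<open>simple_graph\<close> carries the well-formedness conditions (finite, loopless, no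
  multiple edges).
\<close>

type_synonym 'a graph = "'a set \<times> 'a set set"

abbreviation verts :: "'a graph \<Rightarrow> 'a set" where
  "verts G \<equiv> fst G"

abbreviation edges :: "'a graph \<Rightarrow> 'a set set" where
  "edges G \<equiv> snd G"

definition simple_graph :: "'a graph \<Rightarrow> bool" where
  "simple_graph G \<longleftrightarrow>
     finite (verts G) \<and> (\<forall>e\<in>edges G. e \<subseteq> verts G \<and> card e = 2)"

definition subgraph :: "'a graph \<Rightarrow> 'a graph \<Rightarrow> bool" where
  "subgraph H G \<longleftrightarrow>
     simple_graph H \<and> verts H \<subseteq> verts G \<and> edges H \<subseteq> edges G"

definition vdegree :: "'a graph \<Rightarrow> 'a \<Rightarrow> nat" where
  "vdegree G v = card {e \<in> edges G. v \<in> e}"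

definition regular_graph :: "nat \<Rightarrow> 'a graph \<Rightarrow> bool" where
  "regular_graph k G \<longleftrightarrow> (\<forall>v\<in>verts G. vdegree G v = k)"

definition independent_set :: "'a graph \<Rightarrow> 'a set \<Rightarrow> bool" where
  "independent_set G S \<longleftrightarrow>
     S \<subseteq> verts G \<and> (\<forall>u\<in>S. \<forall>v\<in>S. {u, v} \<notin> edges G)"

definition reachable :: "'a graph \<Rightarrow> 'a \<Rightarrow> 'a \<Rightarrow> bool" where
  "reachable G = (\<lambda>u v. {u, v} \<in> edges G)\<^sup>*\<^sup>*"

definition connected_graph :: "'a graph \<Rightarrow> bool" where
  "connected_graph G \<longleftrightarrow>
     verts G \<noteq> {} \<and> (\<forall>u\<in>verts G. \<forall>v\<in>verts G. reachable G u v)"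

definition induced_subgraph :: "'a graph \<Rightarrow> 'a set \<Rightarrow> 'a graph" where
  "induced_subgraph G W = (W, {e \<in> edges G. e \<subseteq> W})"

definition graph_components :: "'a graph \<Rightarrow> 'a graph set" where
  "graph_components G =
     (\<lambda>u. induced_subgraph G {v \<in> verts G. reachable G u v}) ` verts G"

definition is_cycle :: "'a graph \<Rightarrow> bool" where
  "is_cycle G \<longleftrightarrow>
     (\<exists>vs. 3 \<le> length vs \<and> distinct vs \<and> verts G = set vs \<and>
        edges G = {{vs ! i, vs ! (Suc i mod length vs)} | i. i < length vs})"

definition even_cycle :: "'a graph \<Rightarrow> bool" where
  "even_cycle G \<longleftrightarrow> is_cycle G \<and> even (card (edges G))"

definition is_tree :: "'a graph \<Rightarrow> bool" where
  "is_tree G \<longleftrightarrow>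
     simple_graph G \<and> connected_graph G \<and> \<not> (\<exists>H. subgraph H G \<and> is_cycle H)"

definition double_star :: "'a graph \<Rightarrow> bool" where
  "double_star G \<longleftrightarrow>
     is_tree G \<and> card (verts G) = 6 \<and>
     (\<exists>u\<in>verts G. \<exists>v\<in>verts G.
        {u, v} \<in> edges G \<and> vdegree G u = 3 \<and> vdegree G v = 3)"

definition leaves :: "'a graph \<Rightarrow> 'a set" where
  "leaves G = {v \<in> verts G. vdegree G v = 1}"

text \<open>Distinct components are vertex-disjoint by construction.\<close>

definition independent_double_stars :: "'a graph \<Rightarrow> 'a graph \<Rightarrow> bool" where
  "independent_double_stars G F \<longleftrightarrow>
     (\<forall>K\<in>graph_components F. double_star K) \<and>
     independent_set G (\<Union>K\<in>graph_components F. leaves K)"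

definition is_matching :: "'a graph \<Rightarrow> bool" where
  "is_matching H \<longleftrightarrow>
     (\<forall>e\<in>edges H. \<forall>e'\<in>edges H. e \<noteq> e' \<longrightarrow> e \<inter> e' = {})"

text \<open>The parts of a decomposition may be empty.\<close>

definition MED_decomposition ::
    "'a graph \<Rightarrow> 'a graph \<Rightarrow> 'a graph \<Rightarrow> 'a graph \<Rightarrow> bool" where
  "MED_decomposition G G1 G2 G3 \<longleftrightarrow>
     subgraph G1 G \<and> subgraph G2 G \<and> subgraph G3 G \<and>
     edges G1 \<union> edges G2 \<union> edges G3 = edges G \<and>
     edges G1 \<inter> edges G2 = {} \<and> edges G1 \<inter> edges G3 = {} \<and> edges G2 \<inter> edges G3 = {} \<and>
     is_matching G1 \<and>
     (\<forall>K\<in>graph_components G2. even_cycle K) \<and>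
     independent_double_stars G G3"

text \<open>
  The type argument is the type of colours: HOL cannot quantify over it inside the definition, so
  statements leave it as a type variable.
\<close>

definition edge_choosable :: "'c itself \<Rightarrow> nat \<Rightarrow> nat \<Rightarrow> 'a graph \<Rightarrow> bool" where
  "edge_choosable (_ :: 'c itself) r s G \<longleftrightarrow>
     (\<forall>L :: 'a set \<Rightarrow> 'c set.
        (\<forall>e\<in>edges G. finite (L e) \<and> card (L e) = r) \<longrightarrow>
        (\<exists>f :: 'a set \<Rightarrow> 'c set.
           (\<forall>e\<in>edges G. f e \<subseteq> L e \<and> card (f e) = s) \<and>
           (\<forall>e\<in>edges G. \<forall>e'\<in>edges G.
              e \<noteq> e' \<and> e \<inter> e' \<noteq> {} \<longrightarrow> f e \<inter> f e' = {})))"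

end

theory Submission
  imports Defs "HOL-Combinatorics.Cycles" "HOL-Combinatorics.Orbits" "HOL-Library.Disjoint_Sets"
begin

text \<open>
  Every vertex on a cycle of the decomposition has exactly one further edge, its spoke, which lies in
  the matching or is a pendant edge of a double-star. If the spokes get two colours each so that
  every cycle edge loses at most three of its seven colours, the even cycles can be completed by
  Galvin's kernel argument, because four colours are left on each of their edges.

  A cycle edge loses at most three colours as soon as one colour at one end and one colour at the
  other end coincide or are not both in its list. Such colours are chosen, one per cycle vertex, by
  propagation along the cycle: given the colour at the next vertex, either it can be repeated or,
  lists having equal size, some colour outside the list of the cycle edge is available. A matching
  edge receives the colours of its two ends.

  In each half of a double-star one leaf is late: a colour prescribed for it starts the propagation
  towards it, but it commits to nothing until the matching is coloured. Its two neighbours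
  on the cycle are ends of matching edges by independence, and each of its two cycle edges is then
  satisfied by at least two colours of its list. This lets it avoid the single colour forced on its
  sibling. Prescribing the same colour, or a colour missing from the list of the central edge, for
  the two late leaves of a double-star leaves two colours for the central edge.
\<close>

section \<open>Colours and lists\<close>

text \<open>An edge with list \<open>A\<close> loses at most one colour to the pair \<open>c\<close>, \<open>d\<close>.\<close>

definition compatible :: "'c set \<Rightarrow> 'c \<Rightarrow> 'c \<Rightarrow> bool" where
  "compatible A c d \<longleftrightarrow> c = d \<or> c \<notin> A \<or> d \<notin> A"

lemma compatible_commute: "compatible A c d \<longleftrightarrow> compatible A d c"
  unfolding compatible_def by blast

lemma card_Int_Un_less_if_compatible:
  assumes fin: "finite P" "finite Q" and mem: "c \<in> P" "d \<in> Q" and compatible: "compatible A c d"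
  shows "card (A \<inter> (P \<union> Q)) < card P + card Q"
proof -
  have "A \<inter> (P \<union> Q) \<subseteq> (P - {c}) \<union> Q \<or> A \<inter> (P \<union> Q) \<subseteq> P \<union> (Q - {d})"
    using compatible mem unfolding compatible_def by blast
  then have "card (A \<inter> (P \<union> Q)) \<le> card ((P - {c}) \<union> Q) \<or>
      card (A \<inter> (P \<union> Q)) \<le> card (P \<union> (Q - {d}))"
    using fin by (meson card_mono finite_Diff finite_UnI)
  moreover have "card (P - {c}) < card P" "card (Q - {d}) < card Q"
    using fin mem by (simp_all only: card_Diff1_less)
  ultimately show ?thesis
    using card_Un_le[of "P - {c}" Q] card_Un_le[of P "Q - {d}"] by linarith
qed

definition compatible_with :: "'c set \<Rightarrow> 'c set \<Rightarrow> 'c set" where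
  "compatible_with A Z = {c. \<exists>d\<in>Z. compatible A c d}"

lemma card_Int_compatible_with_ge:
  assumes fin: "finite A" "finite X" and card: "card A = card X" "card Z \<le> card X"
  shows "card Z \<le> card (X \<inter> compatible_with A Z)"
proof (cases "Z \<subseteq> A")
  case True
  then have "finite Z" using fin(1) by (rule finite_subset)
  have "card Z = card (Z - X) + card (Z \<inter> X)"
    using card_Int_Diff[OF \<open>finite Z\<close>, of X] by simp
  also have "card (Z - X) \<le> card (A - X)"
    using True fin(1) by (intro card_mono) auto
  also have "card (A - X) \<le> card (X - A)"
    using fin card(1) by (intro card_le_sym_Diff) simp_all
  also have "card (X - A) + card (Z \<inter> X) = card ((X - A) \<union> (Z \<inter> X))"
    using fin \<open>finite Z\<close> True by (intro card_Un_disjoint[symmetric]) auto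
  also have "card ((X - A) \<union> (Z \<inter> X)) \<le> card (X \<inter> compatible_with A Z)" if "Z \<noteq> {}"
    using fin(2) that by (intro card_mono) (auto simp: compatible_with_def compatible_def)
  finally show ?thesis by (cases "Z = {}") simp_all
next
  case False
  then have "X \<inter> compatible_with A Z = X" unfolding compatible_with_def compatible_def by blast
  then show ?thesis using card(2) by simp
qed

lemma ex_compatible:
  assumes "finite A" "card A = card X" "finite X" "X \<noteq> {}"
  shows "\<exists>d\<in>X. compatible A d c"
proof -
  have "card {c} \<le> card X" using assms(3,4) by (simp add: Suc_le_eq card_gt_0_iff)
  then have "card {c} \<le> card (X \<inter> compatible_with A {c})"
    using assms by (intro card_Int_compatible_with_ge) simp_all
  then have "X \<inter> compatible_with A {c} \<noteq> {}" by auto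
  then show ?thesis unfolding compatible_with_def by blast
qed

lemma ex_mem_card_Int_insert_le:
  assumes "finite K" "card (K \<inter> W) \<le> m" "card K < card C + m" "0 < card C"
  shows "\<exists>x\<in>C. card (K \<inter> insert x W) \<le> m"
proof (cases "C \<subseteq> K - W")
  case True
  obtain x where "x \<in> C" using assms(4) by fastforce
  have "card C \<le> card (K - W)" using True assms(1) by (intro card_mono) simp_all
  then have "card (K \<inter> W) < m" using card_Int_Diff[OF assms(1), of W] assms(3) by linarith
  moreover have "card (K \<inter> insert x W) \<le> Suc (card (K \<inter> W))"
    using assms(1) by (simp add: Int_insert_right card_insert_if)
  ultimately have "card (K \<inter> insert x W) \<le> m" by linarith
  then show ?thesis using \<open>x \<in> C\<close> by (rule bexI)
next
  case False
  then obtain x where x: "x \<in> C" "x \<notin> K \<or> x \<in> W" by blast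
  then have "K \<inter> insert x W = K \<inter> W" by blast
  then show ?thesis using x(1) assms(2) by metis
qed

lemma ex_hitting_set_avoiding:
  assumes fin: "finite \<F>" and two: "\<And>F. F \<in> \<F> \<Longrightarrow> 2 \<le> card F" and r: "r \<in> \<Union>\<F>"
  shows "\<exists>P\<subseteq>\<Union>\<F>. card P \<le> card \<F> \<and> s \<notin> P \<and> r \<in> insert s P \<and> (\<forall>F\<in>\<F>. P \<inter> F \<noteq> {})"
proof -
  obtain R where R: "R \<in> \<F>" "r \<in> R" using r by blast
  have "\<exists>c\<in>F - {s}. F = R \<longrightarrow> r \<noteq> s \<longrightarrow> c = r" if F: "F \<in> \<F>" for F
  proof -
    have "\<not> F \<subseteq> {s}" using two[OF F] card_mono[of "{s}" F] by auto
    then show ?thesis using R(2) by blast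
  qed
  then obtain h where h: "\<And>F. F \<in> \<F> \<Longrightarrow> h F \<in> F - {s}" "r \<noteq> s \<Longrightarrow> h R = r"
    using R(1) by metis
  show ?thesis
  proof (intro exI[of _ "h ` \<F>"] conjI ballI)
    show "r \<in> insert s (h ` \<F>)" using h(2) R(1) by blast
    show "card (h ` \<F>) \<le> card \<F>" using fin by (rule card_image_le)
  qed (use h(1) in auto)
qed

lemma ex_extension_card_Int_le:
  assumes "finite Y" "finite K" "finite N" "n + card N \<le> card Y" "card K + n + card N \<le> card Y + m"
    and "P \<subseteq> Y" "P \<inter> N = {}" "P \<subseteq> W" "card P \<le> n" "card (K \<inter> W) \<le> m"
  shows "\<exists>Q. P \<subseteq> Q \<and> Q \<subseteq> Y \<and> Q \<inter> N = {} \<and> card Q = n \<and> card (K \<inter> (W \<union> Q)) \<le> m"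
  using assms(6-)
proof (induction "n - card P" arbitrary: P W)
  case 0
  moreover have "W \<union> P = W" using \<open>P \<subseteq> W\<close> by blast
  ultimately show ?case by (intro exI[of _ P]) simp
next
  case (Suc k)
  have finite_P: "finite P" using Suc.prems(1) assms(1) by (rule finite_subset)
  have "card P < n" using Suc.hyps(2) by linarith
  have "card Y - (card P + card N) \<le> card Y - card (P \<union> N)"
    using card_Un_le[of P N] by linarith
  also have "\<dots> \<le> card (Y - (P \<union> N))"
    using finite_P assms(3) by (intro diff_card_le_card_Diff) simp
  finally have "card K < card (Y - (P \<union> N)) + m" "0 < card (Y - (P \<union> N))"
    using assms(4,5) \<open>card P < n\<close> by linarith+
  then obtain x where x: "x \<in> Y - (P \<union> N)" "card (K \<inter> insert x W) \<le> m"
    using ex_mem_card_Int_insert_le[OF assms(2) Suc.prems(5)] by blast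
  have "card (insert x P) = Suc (card P)" using x(1) finite_P by simp
  then have "k = n - card (insert x P)" "card (insert x P) \<le> n"
    using Suc.hyps(2) \<open>card P < n\<close> by simp_all
  moreover have "insert x P \<subseteq> Y" "insert x P \<inter> N = {}" "insert x P \<subseteq> insert x W"
    using x(1) Suc.prems(1-3) by blast+
  ultimately obtain Q where Q: "insert x P \<subseteq> Q" "Q \<subseteq> Y" "Q \<inter> N = {}" "card Q = n"
    "card (K \<inter> (insert x W \<union> Q)) \<le> m"
    using Suc.hyps(1)[of "insert x P" "insert x W"] x(2) by blast
  moreover have "insert x W \<union> Q = W \<union> Q" using Q(1) by blast
  ultimately show ?case by (intro exI[of _ Q]) simp
qed

lemma ex_disjoint_pairs_card_Int_le:
  assumes "finite K" "4 \<le> card X" "4 \<le> card Y" "card K + 4 \<le> card X + m" "card K + 4 \<le> card Y + m"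
    and "s \<in> X" "P \<subseteq> Y" "s \<notin> P" "card P \<le> 2" "insert s P \<subseteq> W" "card (K \<inter> W) \<le> m"
  shows "\<exists>f g. f \<subseteq> X \<and> card f = 2 \<and> s \<in> f \<and> g \<subseteq> Y \<and> card g = 2 \<and> P \<subseteq> g \<and> f \<inter> g = {} \<and>
    card (K \<inter> (W \<union> f \<union> g)) \<le> m"
proof -
  have finite_lists: "finite X" "finite Y" using assms(2,3) by (auto intro: card_ge_0_finite)
  have "\<exists>g. P \<subseteq> g \<and> g \<subseteq> Y \<and> g \<inter> {s} = {} \<and> card g = 2 \<and> card (K \<inter> (W \<union> g)) \<le> m"
    using assms finite_lists by (intro ex_extension_card_Int_le) simp_all
  then obtain g where g: "P \<subseteq> g" "g \<subseteq> Y" "s \<notin> g" "card g = 2" "card (K \<inter> (W \<union> g)) \<le> m"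
    by blast
  have "finite g" using g(2) finite_lists(2) by (rule finite_subset)
  then have "\<exists>f. {s} \<subseteq> f \<and> f \<subseteq> X \<and> f \<inter> g = {} \<and> card f = 2 \<and> card (K \<inter> (W \<union> g \<union> f)) \<le> m"
    using assms finite_lists g by (intro ex_extension_card_Int_le) simp_all
  then obtain f where "s \<in> f" "f \<subseteq> X" "f \<inter> g = {}" "card f = 2" "card (K \<inter> (W \<union> g \<union> f)) \<le> m"
    by blast
  moreover have "W \<union> g \<union> f = W \<union> f \<union> g" by blast
  ultimately show ?thesis using g(1,2,4) by metis
qed

section \<open>Kernels\<close>

definition is_kernel :: "'v rel \<Rightarrow> 'v set \<Rightarrow> 'v set \<Rightarrow> bool" where
  "is_kernel R S K \<longleftrightarrow> K \<subseteq> S \<and> (\<forall>v\<in>K. R `` {v} \<inter> K = {}) \<and> (\<forall>v\<in>S - K. R `` {v} \<inter> K \<noteq> {})"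

lemma is_kernel_nonempty: "is_kernel R S K \<Longrightarrow> S \<noteq> {} \<Longrightarrow> K \<noteq> {}"
  unfolding is_kernel_def by blast

definition kernel_perfect :: "'v rel \<Rightarrow> 'v set \<Rightarrow> bool" where
  "kernel_perfect R V \<longleftrightarrow> (\<forall>S\<subseteq>V. \<exists>K. is_kernel R S K)"

definition disjoint_choice ::
    "'v rel \<Rightarrow> 'v set \<Rightarrow> ('v \<Rightarrow> 'c set) \<Rightarrow> ('v \<Rightarrow> nat) \<Rightarrow> ('v \<Rightarrow> 'c set) \<Rightarrow> bool" where
  "disjoint_choice R V B d f \<longleftrightarrow>
     (\<forall>v\<in>V. f v \<subseteq> B v \<and> card (f v) = d v \<and> (\<forall>w\<in>R `` {v} \<inter> V. f v \<inter> f w = {}))"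

text \<open>Galvin's method: a colour \<open>x\<close> is given to a kernel of the vertices that list it, so a vertex
  loses it without receiving it only if an out-neighbour receives it.\<close>

lemma demand_le_card_remove_if_kernel:
  fixes d :: "'v \<Rightarrow> nat"
  assumes "finite V" and kernel: "is_kernel R {v \<in> V. 0 < d v \<and> x \<in> B v} K"
    and large: "d v + sum d (R `` {v} \<inter> V) \<le> card (B v)" and v: "v \<in> V" "0 < d v"
  defines "d' \<equiv> \<lambda>v. d v - of_bool (v \<in> K)"
  shows "d' v + sum d' (R `` {v} \<inter> V) \<le> card (B v - {x})"
proof -
  have d'_le: "d' w \<le> d w" for w unfolding d'_def by simp
  have d'_less: "d' w < d w" "w \<in> V" if "w \<in> K" for w
    using that kernel unfolding is_kernel_def d'_def by auto
  have sum_le: "sum d' (R `` {v} \<inter> V) \<le> sum d (R `` {v} \<inter> V)"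
    using d'_le by (intro sum_mono)
  have sum_less: "sum d' (R `` {v} \<inter> V) < sum d (R `` {v} \<inter> V)" if "x \<in> B v" "v \<notin> K"
  proof -
    obtain w where "w \<in> K" "w \<in> R `` {v}"
      using kernel v \<open>x \<in> B v\<close> \<open>v \<notin> K\<close> unfolding is_kernel_def by blast
    then show ?thesis using \<open>finite V\<close> d'_le d'_less by (intro sum_strict_mono_ex1) auto
  qed
  have "d' v + sum d' (R `` {v} \<inter> V) + of_bool (x \<in> B v) \<le> d v + sum d (R `` {v} \<inter> V)"
    using sum_le sum_less d'_le[of v] d'_less(1)[of v]
    by (cases "x \<in> B v"; cases "v \<in> K") simp_all
  then show ?thesis using large by (cases "x \<in> B v") simp_all
qed

lemma disjoint_choice_insert_on_kernel:
  fixes d :: "'v \<Rightarrow> nat"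
  assumes kernel: "is_kernel R {v \<in> V. 0 < d v \<and> x \<in> B v} K" and finite_B: "\<And>v. v \<in> V \<Longrightarrow> finite (B v)"
    and f: "disjoint_choice R V (\<lambda>v. B v - {x}) (\<lambda>v. d v - of_bool (v \<in> K)) f"
  shows "disjoint_choice R V B d (\<lambda>v. if v \<in> K then insert x (f v) else f v)"
  unfolding disjoint_choice_def
proof (intro ballI conjI)
  fix v assume v: "v \<in> V"
  have choice: "f w \<subseteq> B w - {x}" "card (f w) = d w - of_bool (w \<in> K)"
    "\<And>u. u \<in> R `` {w} \<inter> V \<Longrightarrow> f w \<inter> f u = {}"
    if "w \<in> V" for w
    using f that unfolding disjoint_choice_def by blast+
  have in_K: "0 < d v" "x \<in> B v" if "v \<in> K" using that kernel unfolding is_kernel_def by auto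
  show "(if v \<in> K then insert x (f v) else f v) \<subseteq> B v" using choice(1)[OF v] in_K(2) by auto
  have "finite (f v)" using choice(1)[OF v] finite_B[OF v] by (meson finite_Diff finite_subset)
  moreover have "x \<notin> f v" using choice(1)[OF v] by blast
  ultimately show "card (if v \<in> K then insert x (f v) else f v) = d v"
    using choice(2)[OF v] in_K(1) by auto
  fix w assume w: "w \<in> R `` {v} \<inter> V"
  then have "\<not> (v \<in> K \<and> w \<in> K)" using kernel unfolding is_kernel_def by blast
  moreover have "x \<notin> f v" "x \<notin> f w" "f v \<inter> f w = {}"
    using choice(1)[of v] choice(1)[of w] choice(3)[OF v w] v w by blast+
  ultimately
  show "(if v \<in> K then insert x (f v) else f v) \<inter> (if w \<in> K then insert x (f w) else f w) = {}"
    by auto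
qed

lemma ex_disjoint_choice_if_kernel_perfect:
  fixes d :: "'v \<Rightarrow> nat" and B :: "'v \<Rightarrow> 'c set"
  assumes "finite V" and perfect: "kernel_perfect R V"
    and "\<And>v. v \<in> V \<Longrightarrow> finite (B v)"
    and "\<And>v. v \<in> V \<Longrightarrow> 0 < d v \<Longrightarrow> d v + sum d (R `` {v} \<inter> V) \<le> card (B v)"
  shows "\<exists>f. disjoint_choice R V B d f"
  using assms(3,4)
proof (induction "sum d V" arbitrary: d B rule: less_induct)
  case less
  show ?case
  proof (cases "\<forall>v\<in>V. d v = 0")
    case True
    then show ?thesis by (intro exI[of _ "\<lambda>_. {}"]) (simp add: disjoint_choice_def)
  next
    case False
    then obtain u where u: "u \<in> V" "0 < d u" by blast
    then have "0 < card (B u)" using less.prems(2)[OF u] by linarith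
    then obtain x where x: "x \<in> B u" by fastforce
    define S where "S = {v \<in> V. 0 < d v \<and> x \<in> B v}"
    have "S \<subseteq> V" unfolding S_def by blast
    then obtain K where kernel: "is_kernel R S K" using perfect unfolding kernel_perfect_def by blast
    moreover have "S \<noteq> {}" using u x unfolding S_def by blast
    ultimately obtain k where k: "k \<in> K" using is_kernel_nonempty by blast
    then have "k \<in> V" "0 < d k" using kernel unfolding is_kernel_def S_def by auto
    define d' where "d' v = d v - of_bool (v \<in> K)" for v
    have "sum d' V < sum d V"
      using \<open>finite V\<close> k \<open>k \<in> V\<close> \<open>0 < d k\<close>
      by (intro sum_strict_mono_ex1) (auto simp: d'_def intro!: bexI[of _ k])
    moreover have "finite (B v - {x})" if "v \<in> V" for v using less.prems(1)[OF that] by simp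
    moreover have "d' v + sum d' (R `` {v} \<inter> V) \<le> card (B v - {x})" if v: "v \<in> V" "0 < d' v" for v
    proof -
      have dv: "0 < d v" using v(2) unfolding d'_def by simp
      show ?thesis
        using demand_le_card_remove_if_kernel[OF \<open>finite V\<close> kernel[unfolded S_def]
            less.prems(2)[OF v(1) dv] v(1) dv]
        unfolding d'_def .
    qed
    ultimately have "\<exists>f. disjoint_choice R V (\<lambda>v. B v - {x}) d' f" by (rule less.hyps)
    then show ?thesis
      using disjoint_choice_insert_on_kernel[OF kernel[unfolded S_def] less.prems(1)]
      unfolding d'_def by blast
  qed
qed

text \<open>A vertex whose orbit leaves \<open>S\<close> is put into the kernel according to the parity of its exit
  time, the other vertices according to their colour.\<close>

lemma kernel_perfect_two_coloured_map:
  assumes two_colouring: "\<And>v. v \<in> V \<Longrightarrow> c (s v) \<longleftrightarrow> \<not> c v"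
  shows "kernel_perfect {(v, s v) | v. True} V"
  unfolding kernel_perfect_def
proof (intro allI impI)
  fix S assume S: "S \<subseteq> V"
  define exits where "exits v \<longleftrightarrow> (\<exists>m. (s ^^ m) v \<notin> S)" for v
  define exit_time where "exit_time v = (LEAST m. (s ^^ m) v \<notin> S)" for v
  define K where "K = {v. if exits v then odd (exit_time v) else c v}"
  have exits_step: "exits (s v) \<longleftrightarrow> exits v" if "v \<in> S" for v
  proof -
    have "exits v \<longleftrightarrow> (s ^^ 0) v \<notin> S \<or> (\<exists>m. (s ^^ Suc m) v \<notin> S)"
      unfolding exits_def by (metis not0_implies_Suc)
    then show ?thesis using that unfolding exits_def by (simp add: funpow_swap1)
  qed
  have exit_time_step: "exit_time v = Suc (exit_time (s v))" if v: "v \<in> S" "exits v" for v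
  proof -
    obtain m where "(s ^^ m) v \<notin> S" using v(2) unfolding exits_def by blast
    then have "exit_time v = Suc (LEAST m. (s ^^ Suc m) v \<notin> S)"
      unfolding exit_time_def by (rule Least_Suc) (use v(1) in simp)
    then show ?thesis unfolding exit_time_def by (simp add: funpow_swap1)
  qed
  have K_step: "s v \<in> K \<longleftrightarrow> v \<notin> K" if "v \<in> S" for v
    using that S two_colouring exits_step exit_time_step unfolding K_def by auto
  have "K \<subseteq> S"
  proof (rule subsetI, rule ccontr)
    fix v assume v: "v \<in> K" "v \<notin> S"
    then have "(s ^^ 0) v \<notin> S" by simp
    then have "exits v" "exit_time v = 0"
      unfolding exits_def exit_time_def by (blast, simp)
    then show False using v(1) unfolding K_def by simp
  qed
  then have "is_kernel {(v, s v) | v. True} S K"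
    using K_step unfolding is_kernel_def by auto
  then show "\<exists>K. is_kernel {(v, s v) | v. True} S K" ..
qed

section \<open>Propagation\<close>

lemma ex_propagation:
  fixes p :: "'v \<Rightarrow> 'v" and r :: "'v \<Rightarrow> 'x"
  assumes reach: "\<And>v. v \<in> V \<Longrightarrow> \<exists>m. (p ^^ m) v \<in> T"
    and step: "\<And>v x. v \<in> V - T \<Longrightarrow> \<exists>y. Q v y x"
  shows "\<exists>\<sigma>. (\<forall>v\<in>T. \<sigma> v = r v) \<and> (\<forall>v\<in>V - T. Q v (\<sigma> v) (\<sigma> (p v)))"
proof -
  define depth where "depth v = (LEAST m. (p ^^ m) v \<in> T)" for v
  define P where "P \<sigma> v x \<longleftrightarrow> (v \<in> T \<longrightarrow> x = r v) \<and> (v \<in> V - T \<longrightarrow> Q v x (\<sigma> (p v)))" for \<sigma> v x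
  have depth: "depth v = Suc (depth (p v))" if v: "v \<in> V - T" for v
  proof -
    obtain m where "(p ^^ m) v \<in> T" using reach v by blast
    then have "depth v = Suc (LEAST m. (p ^^ Suc m) v \<in> T)"
      unfolding depth_def by (rule Least_Suc) (use v in simp)
    then show ?thesis unfolding depth_def by (simp add: funpow_swap1)
  qed
  have "\<exists>\<sigma>. \<forall>v. P \<sigma> v (\<sigma> v)"
  proof (rule dependent_wf_choice)
    show "wf (Wellfounded.measure depth)" by simp
    show "P f v x = P g v x" if "\<And>w. (w, v) \<in> Wellfounded.measure depth \<Longrightarrow> f w = g w" for f g v x
      using that[of "p v"] depth[of v] unfolding P_def by auto
    show "\<exists>x. P \<sigma> v x" for v \<sigma>
      using step[of v] unfolding P_def by blast
  qed
  then show ?thesis unfolding P_def by blast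
qed

section \<open>Neighbours and components\<close>

definition neighbours :: "'a graph \<Rightarrow> 'a \<Rightarrow> 'a set" where
  "neighbours H v = {w. {v, w} \<in> edges H}"

lemma neighbours_commute: "w \<in> neighbours H v \<longleftrightarrow> v \<in> neighbours H w"
  unfolding neighbours_def by (simp add: insert_commute)

lemma simple_graph_edgeE:
  assumes "simple_graph H" "e \<in> edges H" "v \<in> e"
  obtains w where "e = {v, w}" "v \<noteq> w" "v \<in> verts H" "w \<in> verts H" "w \<in> neighbours H v"
proof -
  have e: "e \<subseteq> verts H" "card e = 2" using assms unfolding simple_graph_def by blast+
  then obtain a b where "e = {a, b}" "a \<noteq> b" by (meson card_2_iff)
  then obtain w where "e = {v, w}" "v \<noteq> w" using assms(3) by blast
  then show thesis using that e(1) assms(2) unfolding neighbours_def by simp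
qed

lemma simple_graph_edge_nonempty:
  assumes "simple_graph H" "e \<in> edges H"
  obtains v where "v \<in> e"
  using assms unfolding simple_graph_def by fastforce

lemma simple_graph_finite_edges: "simple_graph H \<Longrightarrow> finite (edges H)"
  using finite_subset[of "edges H" "Pow (verts H)"] unfolding simple_graph_def by blast

lemma neighbours_in_verts:
  assumes "simple_graph H" "w \<in> neighbours H v"
  shows "v \<in> verts H" "w \<in> verts H" "v \<noteq> w"
  using assms unfolding simple_graph_def neighbours_def by fastforce+

lemma vdegree_eq_card_neighbours:
  assumes "simple_graph H"
  shows "vdegree H v = card (neighbours H v)"
proof -
  have "{e \<in> edges H. v \<in> e} = (\<lambda>w. {v, w}) ` neighbours H v"
    using simple_graph_edgeE[OF assms] unfolding neighbours_def by blast
  moreover have "inj_on (\<lambda>w. {v, w}) (neighbours H v)"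
    by (auto simp: inj_on_def doubleton_eq_iff)
  ultimately show ?thesis unfolding vdegree_def by (simp add: card_image)
qed

lemma vdegree_eq_0_if_notin_verts:
  assumes "simple_graph H" "v \<notin> verts H"
  shows "vdegree H v = 0"
proof -
  have "neighbours H v = {}" using neighbours_in_verts(1)[OF assms(1), of _ v] assms(2) by blast
  then show ?thesis by (simp add: vdegree_eq_card_neighbours[OF assms(1)])
qed

definition component :: "'a graph \<Rightarrow> 'a \<Rightarrow> 'a graph" where
  "component H v = induced_subgraph H {w \<in> verts H. reachable H v w}"

lemma graph_components_eq: "graph_components H = component H ` verts H"
  unfolding graph_components_def component_def ..

lemma component_in_graph_components: "v \<in> verts H \<Longrightarrow> component H v \<in> graph_components H"
  unfolding graph_components_eq by (rule imageI)

lemma verts_component: "verts (component H v) = {w \<in> verts H. reachable H v w}"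
  unfolding component_def induced_subgraph_def by simp

lemma edges_component: "edges (component H v) = {e \<in> edges H. e \<subseteq> verts (component H v)}"
  unfolding component_def induced_subgraph_def by simp

lemma mem_verts_component_self: "v \<in> verts H \<Longrightarrow> v \<in> verts (component H v)"
  unfolding verts_component reachable_def by simp

lemma reachable_sym: "reachable H v w \<Longrightarrow> reachable H w v"
  unfolding reachable_def
  by (rule sympD[OF symp_rtranclp]) (simp_all add: symp_def insert_commute)

lemma component_eq_if_mem:
  assumes "w \<in> verts (component H v)"
  shows "component H w = component H v"
proof -
  have "reachable H v w" using assms unfolding verts_component by simp
  moreover have "reachable H w v" by (rule reachable_sym) fact
  ultimately have "reachable H v x \<longleftrightarrow> reachable H w x" for x
    unfolding reachable_def by (meson rtranclp_trans)
  then show ?thesis unfolding component_def by simp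
qed

lemma component_eq_if_mem_graph_components:
  assumes "K \<in> graph_components H" "v \<in> verts K"
  shows "component H v = K"
  using assms component_eq_if_mem[of v H] unfolding graph_components_eq by auto

lemma verts_edges_graph_components:
  assumes "K \<in> graph_components H"
  shows "verts K \<subseteq> verts H" "edges K \<subseteq> edges H" "\<Union> (edges K) \<subseteq> verts K"
  using assms unfolding graph_components_eq by (auto simp: verts_component edges_component)

lemma edge_mem_component:
  assumes simple: "simple_graph H" and e: "e \<in> edges H" "v \<in> e"
  shows "component H v \<in> graph_components H" "e \<in> edges (component H v)"
proof -
  obtain w where w: "e = {v, w}" "v \<in> verts H" "w \<in> verts H"
    using simple_graph_edgeE[OF simple e] by blast
  then have "reachable H v w" using e(1) unfolding reachable_def by (intro r_into_rtranclp) simp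
  then show "e \<in> edges (component H v)"
    using w e(1) mem_verts_component_self[of v H] by (simp add: edges_component verts_component)
  show "component H v \<in> graph_components H" using w(2) by (rule component_in_graph_components)
qed

lemma neighbours_graph_component:
  assumes "simple_graph H" "K \<in> graph_components H" "v \<in> verts K"
  shows "neighbours K v = neighbours H v"
  using edge_mem_component(2)[OF assms(1), of _ v] verts_edges_graph_components(2)[OF assms(2)]
    component_eq_if_mem_graph_components[OF assms(2,3)] unfolding neighbours_def by auto

lemma simple_graph_component:
  assumes "simple_graph H" "K \<in> graph_components H"
  shows "simple_graph K"
  using assms(1) verts_edges_graph_components[OF assms(2)] finite_subset
  unfolding simple_graph_def by blast

lemma vdegree_graph_component:
  assumes "simple_graph H" "K \<in> graph_components H" "v \<in> verts K"
  shows "vdegree K v = vdegree H v"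
  using neighbours_graph_component[OF assms] simple_graph_component[OF assms(1,2)]
  by (simp add: vdegree_eq_card_neighbours assms(1))

lemma disjoint_verts_graph_components: "disjoint_family_on verts (graph_components H)"
  unfolding disjoint_family_on_def
  using component_eq_if_mem_graph_components by (metis disjoint_iff)

lemma disjoint_edges_graph_components:
  assumes "simple_graph H"
  shows "disjoint_family_on edges (graph_components H)"
  unfolding disjoint_family_on_def
proof (intro ballI impI equals0I)
  fix K K' e assume K: "K \<in> graph_components H" "K' \<in> graph_components H" "K \<noteq> K'"
    and e: "e \<in> edges K \<inter> edges K'"
  then have "e \<in> edges H" using verts_edges_graph_components(2) by blast
  then obtain v where "v \<in> e" using simple_graph_edge_nonempty[OF assms] by blast
  then have "v \<in> verts K \<inter> verts K'" using e K(1,2) verts_edges_graph_components(3) by blast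
  then show False using K disjoint_verts_graph_components[of H] unfolding disjoint_family_on_def by blast
qed

lemma ex_glued_function:
  assumes disj: "disjoint_family_on S I"
    and ex: "\<And>i. i \<in> I \<Longrightarrow> \<exists>f. P i f"
    and local: "\<And>i f g. i \<in> I \<Longrightarrow> (\<And>x. x \<in> S i \<Longrightarrow> f x = g x) \<Longrightarrow> P i f \<Longrightarrow> P i g"
  shows "\<exists>f. \<forall>i\<in>I. P i f"
proof -
  obtain F where F: "\<And>i. i \<in> I \<Longrightarrow> P i (F i)" using ex by metis
  define f where "f x = F (SOME i. i \<in> I \<and> x \<in> S i) x" for x
  have "P i f" if i: "i \<in> I" for i
  proof (rule local[OF i _ F[OF i]])
    fix x assume x: "x \<in> S i"
    have "(SOME j. j \<in> I \<and> x \<in> S j) = i"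
      using disj i x unfolding disjoint_family_on_def by (intro some_equality) blast+
    then show "F i x = f x" unfolding f_def by simp
  qed
  then show ?thesis by blast
qed

section \<open>Multiple list edge colourings\<close>

definition list_edge_colouring ::
    "('a set \<Rightarrow> 'c set) \<Rightarrow> nat \<Rightarrow> 'a set set \<Rightarrow> ('a set \<Rightarrow> 'c set) \<Rightarrow> bool" where
  "list_edge_colouring L k E f \<longleftrightarrow>
     (\<forall>e\<in>E. f e \<subseteq> L e \<and> card (f e) = k) \<and>
     (\<forall>e\<in>E. \<forall>e'\<in>E. e \<noteq> e' \<and> e \<inter> e' \<noteq> {} \<longrightarrow> f e \<inter> f e' = {})"

lemma edge_choosable_iff:
  "edge_choosable TYPE('c) r s G \<longleftrightarrow>
     (\<forall>L :: 'a set \<Rightarrow> 'c set. (\<forall>e\<in>edges G. finite (L e) \<and> card (L e) = r) \<longrightarrow>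
       (\<exists>f. list_edge_colouring L s (edges G) f))"
  unfolding edge_choosable_def list_edge_colouring_def ..

lemma list_edge_colouringD:
  assumes "list_edge_colouring L k E f" "e \<in> E"
  shows "f e \<subseteq> L e" "card (f e) = k" "e' \<in> E \<Longrightarrow> e \<noteq> e' \<Longrightarrow> e \<inter> e' \<noteq> {} \<Longrightarrow> f e \<inter> f e' = {}"
  using assms unfolding list_edge_colouring_def by simp_all

lemma list_edge_colouring_cong:
  assumes "list_edge_colouring L k E f" "\<And>e. e \<in> E \<Longrightarrow> f e = g e"
  shows "list_edge_colouring L k E g"
  using assms unfolding list_edge_colouring_def by simp

lemma list_edge_colouring_mono:
  assumes "list_edge_colouring B k E f" "\<And>e. e \<in> E \<Longrightarrow> B e \<subseteq> L e"
  shows "list_edge_colouring L k E f"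
  using assms unfolding list_edge_colouring_def by blast

lemma list_edge_colouring_Un:
  assumes f: "list_edge_colouring L k E f" and g: "list_edge_colouring L k E' g"
    and cross: "\<And>e e'. e \<in> E \<Longrightarrow> e' \<in> E' \<Longrightarrow> e \<inter> e' \<noteq> {} \<Longrightarrow> f e \<inter> g e' = {}"
  shows "list_edge_colouring L k (E \<union> E') (override_on g f E)"
  unfolding list_edge_colouring_def
proof (intro conjI ballI impI)
  fix e assume e: "e \<in> E \<union> E'"
  show "override_on g f E e \<subseteq> L e" "card (override_on g f E e) = k"
    using e list_edge_colouringD(1,2)[OF f, of e] list_edge_colouringD(1,2)[OF g, of e]
    by (auto simp: override_on_def)
  fix e' assume e': "e' \<in> E \<union> E'" "e \<noteq> e' \<and> e \<inter> e' \<noteq> {}"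
  then have meet: "e \<inter> e' \<noteq> {}" "e' \<inter> e \<noteq> {}" by blast+
  show "override_on g f E e \<inter> override_on g f E e' = {}"
    using e e' meet list_edge_colouringD(3)[OF f, of e e'] list_edge_colouringD(3)[OF g, of e e']
      cross[of e e'] cross[of e' e] by (auto simp: override_on_def)
qed

lemma list_edge_colouring_graph_components:
  assumes simple: "simple_graph H"
    and f: "\<And>K. K \<in> graph_components H \<Longrightarrow> list_edge_colouring L k (edges K) f"
  shows "list_edge_colouring L k (edges H) f"
  unfolding list_edge_colouring_def
proof (intro conjI ballI impI)
  fix e assume e: "e \<in> edges H"
  obtain v where v: "v \<in> e" using simple_graph_edge_nonempty[OF simple e] .
  note comp = f[OF edge_mem_component(1)[OF simple e v]]
  show "f e \<subseteq> L e" "card (f e) = k"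
    using list_edge_colouringD(1,2)[OF comp] edge_mem_component(2)[OF simple e v] by simp_all
  fix e' assume e': "e' \<in> edges H" "e \<noteq> e' \<and> e \<inter> e' \<noteq> {}"
  then obtain w where w: "w \<in> e" "w \<in> e'" by blast
  show "f e \<inter> f e' = {}"
    using list_edge_colouringD(3)[OF f] edge_mem_component[OF simple e w(1)]
      edge_mem_component[OF simple e'(1) w(2)] e'(2) by blast
qed

section \<open>Cycles\<close>

definition cyclic_orientation :: "'a graph \<Rightarrow> ('a \<Rightarrow> 'a) \<Rightarrow> bool" where
  "cyclic_orientation K s \<longleftrightarrow> s permutes verts K \<and> cyclic_on s (verts K) \<and>
     edges K = (\<lambda>v. {v, s v}) ` verts K \<and> (\<forall>v\<in>verts K. s (s v) \<noteq> v)"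

lemma cyclic_orientationD:
  assumes "cyclic_orientation K s"
  shows "s permutes verts K" "cyclic_on s (verts K)" "edges K = (\<lambda>v. {v, s v}) ` verts K"
  using assms unfolding cyclic_orientation_def by simp_all

lemma cycle_of_list_nth:
  assumes "distinct vs" "i < length vs"
  shows "(cycle_of_list vs ^^ m) (vs ! i) = vs ! ((m + i) mod length vs)"
proof -
  have "map (cycle_of_list vs ^^ m) vs ! i = rotate m vs ! i"
    using cyclic_rotation[OF assms(1)] by simp
  then show ?thesis using assms(2) by (simp add: nth_rotate)
qed

lemma is_cycle_orientation:
  assumes "is_cycle K"
  obtains vs where "distinct vs" "verts K = set vs" "cyclic_orientation K (cycle_of_list vs)"
proof -
  obtain vs where n: "3 \<le> length vs" and vs: "distinct vs" "verts K = set vs"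
    and E: "edges K = {{vs ! i, vs ! (Suc i mod length vs)} | i. i < length vs}"
    using assms unfolding is_cycle_def by blast
  let ?s = "cycle_of_list vs"
  have s: "?s (vs ! i) = vs ! (Suc i mod length vs)" if "i < length vs" for i
    using cycle_of_list_nth[OF vs(1) that, of 1] by simp
  have "vs ! i \<in> orbit ?s (vs ! 0)" if i: "i < length vs" for i
  proof -
    have "vs ! i = (?s ^^ i) (vs ! 0)" using cycle_of_list_nth[OF vs(1), of 0 i] i by fastforce
    then show ?thesis unfolding orbit_altdef_permutation[OF permutation_of_cycle] by blast
  qed
  then have "set vs \<subseteq> orbit ?s (vs ! 0)" by (auto simp: in_set_conv_nth)
  moreover have v0: "vs ! 0 \<in> set vs" using n by (intro nth_mem) linarith
  ultimately have "cyclic_on ?s (set vs)"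
    using permutes_orbit_subset[OF cycle_permutes v0] by (intro cyclic_on_singleI[OF v0]) blast
  moreover have "edges K = (\<lambda>v. {v, ?s v}) ` set vs"
    unfolding E by (force simp: s in_set_conv_nth)
  moreover have "?s (?s v) \<noteq> v" if v: "v \<in> set vs" for v
  proof -
    obtain i where i: "i < length vs" "v = vs ! i" using v by (auto simp: in_set_conv_nth)
    have "?s (?s v) = vs ! ((2 + i) mod length vs)"
      using cycle_of_list_nth[OF vs(1) i(1), of 2] i(2) by (simp add: numeral_2_eq_2)
    moreover have "(2 + i) mod length vs < length vs" using n by (intro mod_less_divisor) linarith
    moreover have "(2 + i) mod length vs \<noteq> i"
      using n i(1) by (cases "2 + i < length vs") (auto simp: mod_if)
    ultimately show ?thesis using i vs(1) by (simp add: nth_eq_iff_index_eq)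
  qed
  ultimately show thesis
    using that vs cycle_permutes[of vs] unfolding cyclic_orientation_def by auto
qed

lemma cyclic_orientation_funpow:
  assumes "cyclic_orientation K s" "v \<in> verts K" "w \<in> verts K"
  obtains m where "(s ^^ m) v = w"
proof -
  have "w \<in> orbit s v"
    using cyclic_orientationD(2)[OF assms(1)] assms(2,3) unfolding cyclic_on_alldef by blast
  then show thesis using that unfolding orbit_altdef by blast
qed

lemma cyclic_orientation_in_verts: "cyclic_orientation K s \<Longrightarrow> s v \<in> verts K \<longleftrightarrow> v \<in> verts K"
  by (simp add: cyclic_orientationD(1) permutes_in_image)

lemma cyclic_orientation_edge: "cyclic_orientation K s \<Longrightarrow> v \<in> verts K \<Longrightarrow> {v, s v} \<in> edges K"
  by (simp add: cyclic_orientationD(3))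

lemma inj_on_cyclic_orientation_edge:
  assumes "cyclic_orientation K s"
  shows "inj_on (\<lambda>v. {v, s v}) (verts K)"
  using assms unfolding inj_on_def cyclic_orientation_def by (metis doubleton_eq_iff)

lemma cyclic_orientation_inv:
  assumes s: "cyclic_orientation K s"
  shows "cyclic_orientation K (inv s)"
  unfolding cyclic_orientation_def
proof (intro conjI ballI)
  note perm = cyclic_orientationD(1)[OF s] and cyc = cyclic_orientationD(2)[OF s]
  have "permutation s" using perm finite_cyclic_on[OF cyc] unfolding permutation_permutes by blast
  then show "cyclic_on (inv s) (verts K)" using cyc unfolding cyclic_on_def by (simp add: orbit_inv_eq)
  have bij: "bij s" using perm by (rule permutes_bij)
  show "inv s permutes verts K" using perm by (rule permutes_inv)
  show "edges K = (\<lambda>v. {v, inv s v}) ` verts K"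
  proof -
    have "edges K = (\<lambda>v. {v, s v}) ` inv s ` verts K"
      using cyclic_orientationD(3)[OF s] permutes_image[OF permutes_inv[OF perm]] by simp
    also have "\<dots> = (\<lambda>v. {v, inv s v}) ` verts K"
      using bij by (simp add: image_image surj_f_inv_f bij_is_surj insert_commute)
    finally show ?thesis .
  qed
  show "inv s (inv s v) \<noteq> v" if "v \<in> verts K" for v
    using s that bij unfolding cyclic_orientation_def by (metis bij_inv_eq_iff)
qed

lemma cyclic_orientation_neighbours:
  assumes s: "cyclic_orientation K s" and v: "v \<in> verts K"
  shows "neighbours K v = {s v, inv s v}" "s v \<noteq> inv s v"
proof -
  have bij: "bij s" using cyclic_orientationD(1)[OF s] by (rule permutes_bij)
  have s_inv: "s (inv s v) = v" "inv s v \<in> verts K"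
    using bij cyclic_orientation_in_verts[OF cyclic_orientation_inv[OF s]] v
    by (simp_all add: surj_f_inv_f bij_is_surj)
  show "s v \<noteq> inv s v" using s_inv s v unfolding cyclic_orientation_def by metis
  have "w = s v \<or> w = inv s v" if "{v, w} \<in> edges K" for w
  proof -
    from that obtain u where "{v, w} = {u, s u}" using cyclic_orientationD(3)[OF s] by blast
    then show ?thesis using bij by (metis bij_inv_eq_iff doubleton_eq_iff)
  qed
  moreover have "{v, s v} \<in> edges K" "{v, inv s v} \<in> edges K"
    using cyclic_orientation_edge[OF s v] cyclic_orientation_edge[OF cyclic_orientation_inv[OF s] v]
    by simp_all
  ultimately show "neighbours K v = {s v, inv s v}" unfolding neighbours_def by blast
qed

lemma edge_cyclic_orientation:
  assumes "is_cycle K" "e \<in> edges K" "v \<in> e"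
  obtains s where "cyclic_orientation K s" "v \<in> verts K" "e = {v, s v}"
proof -
  obtain s where s: "cyclic_orientation K s" using assms(1) by (rule is_cycle_orientation)
  then obtain u where u: "u \<in> verts K" "e = {u, s u}"
    using assms(2) cyclic_orientationD(3) by blast
  show thesis
  proof (cases "v = u")
    case True
    then show thesis using that s u by simp
  next
    case False
    then have v: "v = s u" using u assms(3) by simp
    have "inv s v = u"
      using cyclic_orientationD(1)[OF s] unfolding v by (rule permutes_inverses(2))
    then show thesis
      using that[OF cyclic_orientation_inv[OF s]] u v cyclic_orientation_in_verts[OF s]
      by (simp add: insert_commute)
  qed
qed

lemma card_neighbours_cycle:
  assumes "is_cycle K" "v \<in> verts K"
  shows "card (neighbours K v) = 2"
proof -
  obtain s where "cyclic_orientation K s" using assms(1) by (rule is_cycle_orientation)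
  from cyclic_orientation_neighbours[OF this assms(2)] show ?thesis by simp
qed

lemma even_cycle_two_coloured_orientation:
  assumes "even_cycle K"
  obtains s c where "cyclic_orientation K s" "\<And>v. v \<in> verts K \<Longrightarrow> c (s v) \<longleftrightarrow> \<not> c v"
proof -
  obtain vs where vs: "distinct vs" "verts K = set vs" "cyclic_orientation K (cycle_of_list vs)"
    using assms is_cycle_orientation unfolding even_cycle_def by blast
  have "card (edges K) = card (verts K)"
    using cyclic_orientationD(3)[OF vs(3)] card_image[OF inj_on_cyclic_orientation_edge[OF vs(3)]]
    by simp
  then have even: "even (length vs)"
    using assms vs(1,2) unfolding even_cycle_def by (simp add: distinct_card)
  define c where "c v \<longleftrightarrow> (\<exists>i. even i \<and> i < length vs \<and> v = vs ! i)" for v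
  have c: "c (vs ! i) \<longleftrightarrow> even i" if "i < length vs" for i
    using that vs(1) unfolding c_def by (auto simp: nth_eq_iff_index_eq)
  have "c (cycle_of_list vs v) \<longleftrightarrow> \<not> c v" if v: "v \<in> verts K" for v
  proof -
    obtain i where i: "i < length vs" "v = vs ! i" using v vs(2) by (auto simp: in_set_conv_nth)
    have "cycle_of_list vs v = vs ! (Suc i mod length vs)"
      using cycle_of_list_nth[OF vs(1) i(1), of 1] i(2) by simp
    moreover have "Suc i mod length vs < length vs" using i(1) by (intro mod_less_divisor) linarith
    moreover have "even (Suc i mod length vs) \<longleftrightarrow> odd i" using even by (simp add: dvd_mod_iff)
    ultimately show ?thesis using c i by simp
  qed
  then show thesis by (rule that[OF vs(3)])
qed

lemma ex_list_edge_colouring_if_oriented: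
  assumes s: "cyclic_orientation K s"
    and g: "\<forall>v\<in>verts K. g v \<subseteq> L {v, s v} \<and> card (g v) = k \<and> g v \<inter> g (s v) = {}"
  shows "\<exists>f. list_edge_colouring L k (edges K) f"
proof -
  define f where "f e = g (inv_into (verts K) (\<lambda>v. {v, s v}) e)" for e
  have f: "f {v, s v} = g v" if "v \<in> verts K" for v
    unfolding f_def using inv_into_f_f[OF inj_on_cyclic_orientation_edge[OF s] that] by simp
  have "inj s" using cyclic_orientationD(1)[OF s] by (rule permutes_inj)
  have disjoint: "g v \<inter> g w = {}"
    if "v \<in> verts K" "w \<in> verts K" "v \<noteq> w" "{v, s v} \<inter> {w, s w} \<noteq> {}" for v w
  proof -
    have "w = s v \<or> v = s w" using that(3,4) by (auto simp: inj_eq[OF \<open>inj s\<close>])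
    then show ?thesis using g that(1,2) by blast
  qed
  have "list_edge_colouring L k (edges K) f"
    unfolding list_edge_colouring_def cyclic_orientationD(3)[OF s] ball_simps
  proof (intro conjI ballI impI)
    fix v assume v: "v \<in> verts K"
    show "f {v, s v} \<subseteq> L {v, s v}" "card (f {v, s v}) = k" using f[OF v] g v by simp_all
    fix w assume w: "w \<in> verts K" and "{v, s v} \<noteq> {w, s w} \<and> {v, s v} \<inter> {w, s w} \<noteq> {}"
    then show "f {v, s v} \<inter> f {w, s w} = {}" unfolding f[OF v] f[OF w] by (intro disjoint v w) auto
  qed
  then show ?thesis by blast
qed

lemma even_cycle_list_edge_colouring:
  assumes "even_cycle K" and large: "\<And>e. e \<in> edges K \<Longrightarrow> finite (L e) \<and> 2 * k \<le> card (L e)"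
  shows "\<exists>f. list_edge_colouring L k (edges K) f"
proof -
  obtain s and c :: "'a \<Rightarrow> bool" where s: "cyclic_orientation K s"
    and two_colouring: "\<And>v. v \<in> verts K \<Longrightarrow> c (s v) \<longleftrightarrow> \<not> c v"
    using assms(1) by (rule even_cycle_two_coloured_orientation) blast
  let ?R = "{(v, s v) | v. True}" and ?L = "\<lambda>v. L {v, s v}"
  have "finite (verts K)" using cyclic_orientationD(2)[OF s] by (rule finite_cyclic_on)
  moreover have succ: "?R `` {v} \<inter> verts K = {s v}" if "v \<in> verts K" for v
    using that cyclic_orientation_in_verts[OF s] by blast
  moreover have "kernel_perfect ?R (verts K)"
    using two_colouring by (rule kernel_perfect_two_coloured_map)
  ultimately have "\<exists>g. disjoint_choice ?R (verts K) ?L (\<lambda>_. k) g"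
    using large cyclic_orientation_edge[OF s]
    by (intro ex_disjoint_choice_if_kernel_perfect) (simp_all flip: mult_2)
  then obtain g where "disjoint_choice ?R (verts K) ?L (\<lambda>_. k) g" ..
  then have "\<forall>v\<in>verts K. g v \<subseteq> ?L v \<and> card (g v) = k \<and> g v \<inter> g (s v) = {}"
    unfolding disjoint_choice_def by (simp only: succ ball_simps cong: ball_cong) blast
  then show ?thesis by (rule ex_list_edge_colouring_if_oriented[OF s])
qed

lemma even_cycles_list_edge_colouring:
  assumes simple: "simple_graph H" and cycles: "\<And>K. K \<in> graph_components H \<Longrightarrow> even_cycle K"
    and large: "\<And>e. e \<in> edges H \<Longrightarrow> finite (L e) \<and> 2 * k \<le> card (L e)"
  shows "\<exists>f. list_edge_colouring L k (edges H) f"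
proof -
  have "\<exists>f. \<forall>K\<in>graph_components H. list_edge_colouring L k (edges K) f"
  proof (rule ex_glued_function[OF disjoint_edges_graph_components[OF simple]])
    fix K assume K: "K \<in> graph_components H"
    show "\<exists>f. list_edge_colouring L k (edges K) f"
      using large verts_edges_graph_components(2)[OF K]
      by (intro even_cycle_list_edge_colouring[OF cycles[OF K]]) blast
  qed (rule list_edge_colouring_cong)
  then show ?thesis using list_edge_colouring_graph_components[OF simple] by blast
qed

section \<open>Compatible assignments on cycles\<close>

text \<open>A vertex with a colour prescribed by \<open>r\<close> need only be compatible with the neighbour from which the
  propagation reaches it.\<close>

definition compatible_assignment ::
    "('a \<Rightarrow> 'c set) \<Rightarrow> ('a set \<Rightarrow> 'c set) \<Rightarrow> ('a \<rightharpoonup> 'c) \<Rightarrow> 'a graph \<Rightarrow> ('a \<Rightarrow> 'c) \<Rightarrow> bool" where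
  "compatible_assignment L A r H \<sigma> \<longleftrightarrow>
     (\<forall>v\<in>verts H. \<sigma> v \<in> L v \<and> (\<forall>c. r v = Some c \<longrightarrow> \<sigma> v = c) \<and>
       (\<forall>w\<in>neighbours H v. r v = None \<longrightarrow> r w = None \<longrightarrow> compatible (A {v, w}) (\<sigma> v) (\<sigma> w)) \<and>
       (r v \<noteq> None \<longrightarrow> (\<exists>w\<in>neighbours H v. compatible (A {v, w}) (\<sigma> v) (\<sigma> w))))"

lemma compatible_assignment_if_oriented:
  assumes s: "cyclic_orientation K s"
    and mem: "\<And>v. v \<in> verts K \<Longrightarrow> \<sigma> v \<in> L v"
    and prescribed: "\<And>v c. v \<in> verts K \<Longrightarrow> r v = Some c \<Longrightarrow> \<sigma> v = c"
    and isolated: "\<And>v w. v \<in> verts K \<Longrightarrow> w \<in> neighbours K v \<Longrightarrow> r v \<noteq> None \<Longrightarrow> r w = None"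
    and compatible: "\<And>v. v \<in> verts K \<Longrightarrow> r v = None \<Longrightarrow> compatible (A {v, s v}) (\<sigma> v) (\<sigma> (s v))"
  shows "compatible_assignment L A r K \<sigma>"
proof -
  have pred: "compatible (A {v, inv s v}) (\<sigma> v) (\<sigma> (inv s v))"
    if v: "v \<in> verts K" "r (inv s v) = None" for v
  proof -
    have "s (inv s v) = v"
      using cyclic_orientationD(1)[OF s] by (rule permutes_inverses(1))
    moreover have "inv s v \<in> verts K"
      using cyclic_orientation_in_verts[OF cyclic_orientation_inv[OF s]] v(1) by simp
    ultimately have "compatible (A {inv s v, v}) (\<sigma> (inv s v)) (\<sigma> v)" using compatible v(2) by metis
    then show ?thesis using compatible_commute by (metis insert_commute)
  qed
  have "compatible (A {v, w}) (\<sigma> v) (\<sigma> w)"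
    if "v \<in> verts K" "w \<in> neighbours K v" "r v = None" "r w = None" for v w
    using that compatible pred cyclic_orientation_neighbours(1)[OF s] by auto
  moreover have "\<exists>w\<in>neighbours K v. compatible (A {v, w}) (\<sigma> v) (\<sigma> w)"
    if v: "v \<in> verts K" "r v \<noteq> None" for v
  proof -
    have "inv s v \<in> neighbours K v" using cyclic_orientation_neighbours(1)[OF s v(1)] by simp
    then show ?thesis using pred[OF v(1) isolated[OF v(1) _ v(2)]] by blast
  qed
  ultimately show ?thesis using mem prescribed unfolding compatible_assignment_def by blast
qed

lemma ex_propagation_around_cycle:
  assumes s: "cyclic_orientation K s" and t: "t \<in> T" "t \<in> verts K" and "0 < m"
    and card_L: "\<And>v. v \<in> verts K \<Longrightarrow> card (L v) = m" and card_A: "\<And>e. e \<in> edges K \<Longrightarrow> card (A e) = m"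
  shows "\<exists>\<sigma>. (\<forall>v\<in>T. \<sigma> v = r v) \<and>
    (\<forall>v\<in>verts K - T. \<sigma> v \<in> L v \<and> compatible (A {v, s v}) (\<sigma> v) (\<sigma> (s v)))"
proof (rule ex_propagation)
  fix v assume "v \<in> verts K"
  then obtain k where "(s ^^ k) v = t" using cyclic_orientation_funpow[OF s _ t(2)] by blast
  then show "\<exists>k. (s ^^ k) v \<in> T" using t(1) by blast
next
  fix v x assume "v \<in> verts K - T"
  then have card: "card (L v) = m" "card (A {v, s v}) = m"
    using card_L card_A cyclic_orientation_edge[OF s] by simp_all
  then have "finite (L v)" "L v \<noteq> {}" "finite (A {v, s v})"
    using \<open>0 < m\<close> by (auto intro: card_ge_0_finite)
  with ex_compatible[of "A {v, s v}" "L v" x] card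
  show "\<exists>y. y \<in> L v \<and> compatible (A {v, s v}) y x" by auto
qed

lemma ex_compatible_assignment_if_prescribed:
  assumes "is_cycle K" "0 < m" "t \<in> verts K" "r t \<noteq> None"
    and card_L: "\<And>v. v \<in> verts K \<Longrightarrow> card (L v) = m" and card_A: "\<And>e. e \<in> edges K \<Longrightarrow> card (A e) = m"
    and prescribed_in_L: "\<And>v c. v \<in> verts K \<Longrightarrow> r v = Some c \<Longrightarrow> c \<in> L v"
    and isolated: "\<And>v w. v \<in> verts K \<Longrightarrow> w \<in> neighbours K v \<Longrightarrow> r v \<noteq> None \<Longrightarrow> r w = None"
  shows "\<exists>\<sigma>. compatible_assignment L A r K \<sigma>"
proof -
  obtain s where s: "cyclic_orientation K s" using \<open>is_cycle K\<close> by (rule is_cycle_orientation)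
  have "t \<in> dom r" using \<open>r t \<noteq> None\<close> by blast
  then have "\<exists>\<sigma>. (\<forall>v\<in>dom r. \<sigma> v = the (r v)) \<and>
      (\<forall>v\<in>verts K - dom r. \<sigma> v \<in> L v \<and> compatible (A {v, s v}) (\<sigma> v) (\<sigma> (s v)))"
    by (rule ex_propagation_around_cycle[OF s _ \<open>t \<in> verts K\<close> \<open>0 < m\<close> card_L card_A])
  then obtain \<sigma> where \<sigma>: "\<forall>v\<in>dom r. \<sigma> v = the (r v)"
    "\<forall>v\<in>verts K - dom r. \<sigma> v \<in> L v \<and> compatible (A {v, s v}) (\<sigma> v) (\<sigma> (s v))"
    by blast
  have "compatible_assignment L A r K \<sigma>"
  proof (rule compatible_assignment_if_oriented[OF s _ _ isolated])
    show "\<sigma> v \<in> L v" if "v \<in> verts K" for v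
      using \<sigma> prescribed_in_L that by (cases "r v") (auto simp: domIff)
  qed (use \<sigma> in \<open>auto simp: domIff\<close>)
  then show ?thesis by blast
qed

text \<open>The propagation starts at an edge whose list misses a colour of one of its ends: the assignment
  is compatible across that edge for free.\<close>

lemma ex_compatible_assignment_if_lists_differ:
  assumes "is_cycle K" "0 < m" and edge: "e \<in> edges K" "v \<in> e" and "L v \<noteq> A e"
    and card_L: "\<And>v. v \<in> verts K \<Longrightarrow> card (L v) = m" and card_A: "\<And>e. e \<in> edges K \<Longrightarrow> card (A e) = m"
    and free: "\<And>v. v \<in> verts K \<Longrightarrow> r v = None"
  shows "\<exists>\<sigma>. compatible_assignment L A r K \<sigma>"
proof -
  obtain s where s: "cyclic_orientation K s" and v: "v \<in> verts K" "e = {v, s v}"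
    using \<open>is_cycle K\<close> edge by (rule edge_cyclic_orientation)
  have "finite (A e)" using card_A[OF edge(1)] \<open>0 < m\<close> by (simp add: card_ge_0_finite)
  then have "\<not> L v \<subseteq> A e"
    using card_L[OF v(1)] card_A[OF edge(1)] \<open>L v \<noteq> A e\<close> by (metis card_subset_eq)
  then obtain d where d: "d \<in> L v" "d \<notin> A e" by blast
  have "\<exists>\<sigma>. (\<forall>w\<in>{v}. \<sigma> w = d) \<and>
      (\<forall>w\<in>verts K - {v}. \<sigma> w \<in> L w \<and> compatible (A {w, s w}) (\<sigma> w) (\<sigma> (s w)))"
    by (rule ex_propagation_around_cycle[OF s singletonI v(1) \<open>0 < m\<close> card_L card_A])
  then obtain \<sigma> where \<sigma>: "\<sigma> v = d"
    "\<forall>w\<in>verts K - {v}. \<sigma> w \<in> L w \<and> compatible (A {w, s w}) (\<sigma> w) (\<sigma> (s w))"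
    by blast
  then have "\<sigma> w \<in> L w \<and> compatible (A {w, s w}) (\<sigma> w) (\<sigma> (s w))" if "w \<in> verts K" for w
    using d that unfolding v(2) compatible_def by (cases "w = v") auto
  then have "compatible_assignment L A r K \<sigma>"
    using free by (intro compatible_assignment_if_oriented[OF s]) simp_all
  then show ?thesis by blast
qed

lemma ex_compatible_assignment_if_lists_equal:
  assumes "is_cycle K" and equal: "\<And>v e. e \<in> edges K \<Longrightarrow> v \<in> e \<Longrightarrow> L v = A e"
    and nonempty: "\<And>v. v \<in> verts K \<Longrightarrow> L v \<noteq> {}" and free: "\<And>v. v \<in> verts K \<Longrightarrow> r v = None"
  shows "\<exists>\<sigma>. compatible_assignment L A r K \<sigma>"
proof -
  obtain s where s: "cyclic_orientation K s" using \<open>is_cycle K\<close> by (rule is_cycle_orientation)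
  then obtain u where u: "u \<in> verts K" using cyclic_orientationD(2) unfolding cyclic_on_def by blast
  then obtain c where c: "c \<in> L u" using nonempty by blast
  have "(s ^^ k) u \<in> verts K \<and> L ((s ^^ k) u) = L u" for k
  proof (induction k)
    case (Suc k)
    let ?v = "(s ^^ k) u"
    have "{?v, s ?v} \<in> edges K" using Suc cyclic_orientation_edge[OF s] by blast
    then have "L (s ?v) = L ?v" using equal[of "{?v, s ?v}"] by simp
    then show ?case using Suc cyclic_orientation_in_verts[OF s] by simp
  qed (simp add: u)
  then have "c \<in> L v" if "v \<in> verts K" for v
    using cyclic_orientation_funpow[OF s u that] c by metis
  then have "compatible_assignment L A r K (\<lambda>_. c)"
    using free by (intro compatible_assignment_if_oriented[OF s]) (simp_all add: compatible_def)
  then show ?thesis by blast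
qed

lemma ex_compatible_assignment_cycle:
  assumes "is_cycle K" "0 < m"
    and card_L: "\<And>v. v \<in> verts K \<Longrightarrow> card (L v) = m" and card_A: "\<And>e. e \<in> edges K \<Longrightarrow> card (A e) = m"
    and prescribed_in_L: "\<And>v c. v \<in> verts K \<Longrightarrow> r v = Some c \<Longrightarrow> c \<in> L v"
    and isolated: "\<And>v w. v \<in> verts K \<Longrightarrow> w \<in> neighbours K v \<Longrightarrow> r v \<noteq> None \<Longrightarrow> r w = None"
  shows "\<exists>\<sigma>. compatible_assignment L A r K \<sigma>"
proof -
  consider (prescribed) t where "t \<in> verts K" "r t \<noteq> None"
    | (differ) v e where "\<And>v. v \<in> verts K \<Longrightarrow> r v = None" "e \<in> edges K" "v \<in> e" "L v \<noteq> A e"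
    | (equal) "\<And>v. v \<in> verts K \<Longrightarrow> r v = None" "\<And>v e. e \<in> edges K \<Longrightarrow> v \<in> e \<Longrightarrow> L v = A e"
    by blast
  then show ?thesis
  proof cases
    case prescribed
    then show ?thesis
      using card_L card_A prescribed_in_L isolated
      by (rule ex_compatible_assignment_if_prescribed[OF assms(1,2)])
  next
    case differ
    show ?thesis
      using differ(2-4) card_L card_A differ(1)
      by (rule ex_compatible_assignment_if_lists_differ[OF assms(1,2)])
  next
    case equal
    have "L v \<noteq> {}" if "v \<in> verts K" for v using card_L[OF that] \<open>0 < m\<close> by fastforce
    with equal(2) show ?thesis
      using equal(1) by (rule ex_compatible_assignment_if_lists_equal[OF assms(1)])
  qed
qed

lemma ex_compatible_assignment_cycles:
  assumes simple: "simple_graph H" and cycles: "\<And>K. K \<in> graph_components H \<Longrightarrow> is_cycle K"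
    and "0 < m" and card_L: "\<And>v. v \<in> verts H \<Longrightarrow> card (L v) = m"
    and card_A: "\<And>e. e \<in> edges H \<Longrightarrow> card (A e) = m"
    and prescribed_in_L: "\<And>v c. v \<in> verts H \<Longrightarrow> r v = Some c \<Longrightarrow> c \<in> L v"
    and isolated: "\<And>v w. v \<in> verts H \<Longrightarrow> w \<in> neighbours H v \<Longrightarrow> r v \<noteq> None \<Longrightarrow> r w = None"
  shows "\<exists>\<sigma>. compatible_assignment L A r H \<sigma>"
proof -
  have "\<exists>\<sigma>. \<forall>K\<in>graph_components H. compatible_assignment L A r K \<sigma>"
  proof (rule ex_glued_function[OF disjoint_verts_graph_components])
    fix K assume K: "K \<in> graph_components H"
    note sub = verts_edges_graph_components[OF K]
    show "\<exists>\<sigma>. compatible_assignment L A r K \<sigma>"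
    proof (rule ex_compatible_assignment_cycle[OF cycles[OF K] \<open>0 < m\<close>])
      show "r w = None" if "v \<in> verts K" "w \<in> neighbours K v" "r v \<noteq> None" for v w
        using isolated that sub(1) neighbours_graph_component[OF simple K] by blast
    qed (use card_L card_A prescribed_in_L sub in blast)+
    fix \<sigma> \<tau> :: "'a \<Rightarrow> 'b"
    assume eq: "\<And>v. v \<in> verts K \<Longrightarrow> \<sigma> v = \<tau> v" and \<sigma>: "compatible_assignment L A r K \<sigma>"
    have "w \<in> verts K" if "w \<in> neighbours K v" for v w
      using that sub(3) unfolding neighbours_def by blast
    then show "compatible_assignment L A r K \<tau>"
      using \<sigma> eq unfolding compatible_assignment_def by simp
  qed
  then obtain \<sigma> where \<sigma>: "\<forall>K\<in>graph_components H. compatible_assignment L A r K \<sigma>" by blast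
  show ?thesis
    unfolding compatible_assignment_def
  proof (rule exI[of _ \<sigma>], rule ballI)
    fix v assume v: "v \<in> verts H"
    note K = component_in_graph_components[OF v] mem_verts_component_self[OF v]
    from \<sigma>[THEN bspec, OF K(1), unfolded compatible_assignment_def, THEN bspec, OF K(2)]
    show "\<sigma> v \<in> L v \<and> (\<forall>c. r v = Some c \<longrightarrow> \<sigma> v = c) \<and>
      (\<forall>w\<in>neighbours H v. r v = None \<longrightarrow> r w = None \<longrightarrow> compatible (A {v, w}) (\<sigma> v) (\<sigma> w)) \<and>
      (r v \<noteq> None \<longrightarrow> (\<exists>w\<in>neighbours H v. compatible (A {v, w}) (\<sigma> v) (\<sigma> w)))"
      unfolding neighbours_graph_component[OF simple K] .
  qed
qed

section \<open>Double-stars\<close>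

lemma leaves_graph_component:
  assumes "simple_graph H" "K \<in> graph_components H"
  shows "leaves K = leaves H \<inter> verts K"
proof -
  have "v \<in> verts H" "vdegree K v = vdegree H v" if "v \<in> verts K" for v
    using that vdegree_graph_component[OF assms] verts_edges_graph_components(1)[OF assms(2)] by blast+
  then show ?thesis unfolding leaves_def by auto
qed

lemma leaves_eq_Union_graph_components:
  assumes "simple_graph H"
  shows "leaves H = (\<Union>K\<in>graph_components H. leaves K)"
proof -
  have "v \<in> (\<Union>K\<in>graph_components H. verts K)" if "v \<in> verts H" for v
    using component_in_graph_components[OF that] mem_verts_component_self[OF that] by blast
  then have "leaves H = leaves H \<inter> (\<Union>K\<in>graph_components H. verts K)" unfolding leaves_def by blast
  then show ?thesis by (simp add: leaves_graph_component[OF assms])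
qed

lemma tree_path_ends_not_adjacent:
  assumes tree: "is_tree D" and path: "successively (\<lambda>a b. {a, b} \<in> edges D) vs"
    and vs: "distinct vs" "3 \<le> length vs"
  shows "{last vs, hd vs} \<notin> edges D"
proof
  assume closing: "{last vs, hd vs} \<in> edges D"
  have D: "simple_graph D" and acyclic: "\<And>C. subgraph C D \<Longrightarrow> \<not> is_cycle C"
    using tree unfolding is_tree_def by blast+
  define C where "C = (set vs, {{vs ! i, vs ! (Suc i mod length vs)} | i. i < length vs})"
  have "vs \<noteq> []" using vs(2) by auto
  have edge: "{vs ! i, vs ! (Suc i mod length vs)} \<in> edges D" if i: "i < length vs" for i
  proof (cases "Suc i = length vs")
    case True
    then have "last vs = vs ! i" using \<open>vs \<noteq> []\<close> by (metis diff_Suc_1 last_conv_nth)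
    then show ?thesis using closing \<open>vs \<noteq> []\<close> True by (simp add: hd_conv_nth)
  next
    case False
    then show ?thesis using path i by (simp add: successively_conv_nth)
  qed
  have "vs ! i \<in> verts D" if "i < length vs" for i
    using edge[OF that] D unfolding simple_graph_def by blast
  then have "verts C \<subseteq> verts D" unfolding C_def by (auto simp: in_set_conv_nth)
  moreover have "edges C \<subseteq> edges D" using edge unfolding C_def by auto
  moreover have "e \<subseteq> verts C" if "e \<in> edges C" for e
    using that \<open>vs \<noteq> []\<close> unfolding C_def by auto
  moreover have "finite (verts C)" unfolding C_def by simp
  ultimately have "subgraph C D" using D unfolding subgraph_def simple_graph_def by blast
  moreover have "is_cycle C" using vs unfolding C_def is_cycle_def by auto
  ultimately show False using acyclic by blast
qed

lemma tree_edge_meets_dominating_edge: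
  assumes tree: "is_tree D" and uv: "{u, v} \<in> edges D"
    and dominating: "\<And>w. w \<in> verts D \<Longrightarrow> w \<noteq> u \<Longrightarrow> w \<noteq> v \<Longrightarrow> {u, w} \<in> edges D \<or> {v, w} \<in> edges D"
    and e: "e \<in> edges D"
  shows "u \<in> e \<or> v \<in> e"
proof (rule ccontr)
  assume "\<not> (u \<in> e \<or> v \<in> e)"
  then have away: "u \<notin> e" "v \<notin> e" by simp_all
  have D: "simple_graph D" using tree unfolding is_tree_def by blast
  note no_closing_edge = tree_path_ends_not_adjacent[OF tree]
  have "u \<noteq> v" using neighbours_in_verts(3)[OF D, of v u] uv unfolding neighbours_def by simp
  obtain a where "a \<in> e" using simple_graph_edge_nonempty[OF D e] .
  then obtain b where ab: "e = {a, b}" "a \<noteq> b" "a \<in> verts D" "b \<in> verts D"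
    using simple_graph_edgeE[OF D e] by blast
  then have ends_ne: "a \<noteq> u" "a \<noteq> v" "b \<noteq> u" "b \<noteq> v" using away by blast+
  consider w where "w \<in> {u, v}" "{w, a} \<in> edges D" "{w, b} \<in> edges D"
    | "{u, a} \<in> edges D" "{v, b} \<in> edges D" | "{v, a} \<in> edges D" "{u, b} \<in> edges D"
    using dominating[OF ab(3) ends_ne(1,2)] dominating[OF ab(4) ends_ne(3,4)] by blast
  then show False
  proof cases
    case 1
    then show ?thesis using no_closing_edge[of "[b, w, a]"] ends_ne ab e by (auto simp: insert_commute)
  next
    case 2
    then show ?thesis
      using no_closing_edge[of "[b, v, u, a]"] ends_ne ab e uv \<open>u \<noteq> v\<close> by (simp add: insert_commute)
  next
    case 3
    then show ?thesis
      using no_closing_edge[of "[b, u, v, a]"] ends_ne ab e uv \<open>u \<noteq> v\<close> by (simp add: insert_commute)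
  qed
qed

lemma neighbours_if_vdegree_3:
  assumes simple: "simple_graph D" and "vdegree D u = 3" "v \<in> neighbours D u"
  obtains x\<^sub>1 x\<^sub>2 where "neighbours D u = {v, x\<^sub>1, x\<^sub>2}" "distinct [u, v, x\<^sub>1, x\<^sub>2]"
proof -
  have "card (neighbours D u - {v}) = 2"
    using assms by (simp add: vdegree_eq_card_neighbours)
  then obtain x\<^sub>1 x\<^sub>2 where x: "neighbours D u - {v} = {x\<^sub>1, x\<^sub>2}" "x\<^sub>1 \<noteq> x\<^sub>2" by (meson card_2_iff)
  then have N: "neighbours D u = {v, x\<^sub>1, x\<^sub>2}" using assms(3) by blast
  moreover have "v \<notin> {x\<^sub>1, x\<^sub>2}" using x(1) by blast
  moreover have "u \<notin> {v, x\<^sub>1, x\<^sub>2}" using neighbours_in_verts(3)[OF simple] N by blast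
  ultimately show thesis using that x(2) by simp
qed

definition double_star_labelling ::
    "'a graph \<Rightarrow> 'a \<Rightarrow> 'a \<Rightarrow> 'a \<Rightarrow> 'a \<Rightarrow> 'a \<Rightarrow> 'a \<Rightarrow> bool" where
  "double_star_labelling D u v x\<^sub>1 x\<^sub>2 y\<^sub>1 y\<^sub>2 \<longleftrightarrow>
     distinct [u, v, x\<^sub>1, x\<^sub>2, y\<^sub>1, y\<^sub>2] \<and> verts D = {u, v, x\<^sub>1, x\<^sub>2, y\<^sub>1, y\<^sub>2} \<and>
     edges D = {{u, v}, {u, x\<^sub>1}, {u, x\<^sub>2}, {v, y\<^sub>1}, {v, y\<^sub>2}}"

lemma double_star_labellingD:
  assumes "double_star_labelling D u v x\<^sub>1 x\<^sub>2 y\<^sub>1 y\<^sub>2"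
  shows "distinct [u, v, x\<^sub>1, x\<^sub>2, y\<^sub>1, y\<^sub>2]" "verts D = {u, v, x\<^sub>1, x\<^sub>2, y\<^sub>1, y\<^sub>2}"
    "edges D = {{u, v}, {u, x\<^sub>1}, {u, x\<^sub>2}, {v, y\<^sub>1}, {v, y\<^sub>2}}"
  using assms unfolding double_star_labelling_def by simp_all

lemma double_star_centres:
  assumes "double_star D"
  obtains u v x\<^sub>1 x\<^sub>2 y\<^sub>1 y\<^sub>2 where "distinct [u, v, x\<^sub>1, x\<^sub>2, y\<^sub>1, y\<^sub>2]"
    "verts D = {u, v, x\<^sub>1, x\<^sub>2, y\<^sub>1, y\<^sub>2}" "neighbours D u = {v, x\<^sub>1, x\<^sub>2}" "neighbours D v = {u, y\<^sub>1, y\<^sub>2}"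
proof -
  have tree: "is_tree D" and "card (verts D) = 6" using assms unfolding double_star_def by simp_all
  then have simple: "simple_graph D" unfolding is_tree_def by simp
  obtain u v where uv: "{u, v} \<in> edges D" and deg: "vdegree D u = 3" "vdegree D v = 3"
    using assms unfolding double_star_def by blast
  then have "v \<in> neighbours D u" "u \<in> neighbours D v" by (simp_all add: neighbours_def insert_commute)
  then obtain x\<^sub>1 x\<^sub>2 y\<^sub>1 y\<^sub>2 where Nu: "neighbours D u = {v, x\<^sub>1, x\<^sub>2}" "distinct [u, v, x\<^sub>1, x\<^sub>2]"
    and Nv: "neighbours D v = {u, y\<^sub>1, y\<^sub>2}" "distinct [v, u, y\<^sub>1, y\<^sub>2]"
    using neighbours_if_vdegree_3[OF simple deg(1)] neighbours_if_vdegree_3[OF simple deg(2)] by metis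
  have "{x\<^sub>1, x\<^sub>2} \<inter> {y\<^sub>1, y\<^sub>2} = {}"
  proof (rule equals0I)
    fix a assume a: "a \<in> {x\<^sub>1, x\<^sub>2} \<inter> {y\<^sub>1, y\<^sub>2}"
    then have "a \<in> neighbours D u" "a \<in> neighbours D v" unfolding Nu(1) Nv(1) by blast+
    then have "successively (\<lambda>a b. {a, b} \<in> edges D) [u, a, v]"
      by (simp add: neighbours_def insert_commute)
    moreover have "distinct [u, a, v]" using a Nu(2) by auto
    ultimately show False
      using tree_path_ends_not_adjacent[OF tree, of "[u, a, v]"] uv by (simp add: insert_commute)
  qed
  then have distinct: "distinct [u, v, x\<^sub>1, x\<^sub>2, y\<^sub>1, y\<^sub>2]" using Nu(2) Nv(2) by auto
  have "finite (verts D)" using simple unfolding simple_graph_def by blast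
  moreover have "neighbours D u \<union> neighbours D v \<subseteq> verts D"
    using neighbours_in_verts(2)[OF simple] by blast
  then have "{u, v, x\<^sub>1, x\<^sub>2, y\<^sub>1, y\<^sub>2} \<subseteq> verts D" unfolding Nu(1) Nv(1) by blast
  moreover have "card {u, v, x\<^sub>1, x\<^sub>2, y\<^sub>1, y\<^sub>2} = card (verts D)"
    using distinct \<open>card (verts D) = 6\<close> by simp
  ultimately have "{u, v, x\<^sub>1, x\<^sub>2, y\<^sub>1, y\<^sub>2} = verts D" by (rule card_subset_eq)
  then show thesis using that[OF distinct _ Nu(1) Nv(1)] by simp
qed

lemma ex_double_star_labelling:
  assumes "double_star D"
  obtains u v x\<^sub>1 x\<^sub>2 y\<^sub>1 y\<^sub>2 where "double_star_labelling D u v x\<^sub>1 x\<^sub>2 y\<^sub>1 y\<^sub>2"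
proof -
  have tree: "is_tree D" and simple: "simple_graph D"
    using assms unfolding double_star_def is_tree_def by simp_all
  obtain u v x\<^sub>1 x\<^sub>2 y\<^sub>1 y\<^sub>2 where distinct: "distinct [u, v, x\<^sub>1, x\<^sub>2, y\<^sub>1, y\<^sub>2]"
    and V: "verts D = {u, v, x\<^sub>1, x\<^sub>2, y\<^sub>1, y\<^sub>2}"
    and N: "neighbours D u = {v, x\<^sub>1, x\<^sub>2}" "neighbours D v = {u, y\<^sub>1, y\<^sub>2}"
    using assms by (rule double_star_centres)
  let ?E = "{{u, v}, {u, x\<^sub>1}, {u, x\<^sub>2}, {v, y\<^sub>1}, {v, y\<^sub>2}}"
  have adjacent: "{u, w} \<in> edges D" if "w \<in> {v, x\<^sub>1, x\<^sub>2}" for w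
    using that unfolding N(1)[symmetric] neighbours_def by simp
  have adjacent': "{v, w} \<in> edges D" if "w \<in> {u, y\<^sub>1, y\<^sub>2}" for w
    using that unfolding N(2)[symmetric] neighbours_def by simp
  have "e \<in> ?E" if e: "e \<in> edges D" for e
  proof -
    have "u \<in> e \<or> v \<in> e"
      using adjacent adjacent' by (intro tree_edge_meets_dominating_edge[OF tree _ _ e]) (auto simp: V)
    then show ?thesis
    proof
      assume "u \<in> e"
      obtain w where "e = {u, w}" "w \<in> neighbours D u"
        using simple_graph_edgeE[OF simple e \<open>u \<in> e\<close>] by blast
      then show ?thesis unfolding N(1) by auto
    next
      assume "v \<in> e"
      obtain w where "e = {v, w}" "w \<in> neighbours D v"
        using simple_graph_edgeE[OF simple e \<open>v \<in> e\<close>] by blast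
      then show ?thesis unfolding N(2) by (auto simp: insert_commute)
    qed
  qed
  moreover have "?E \<subseteq> edges D" using adjacent adjacent' by simp
  ultimately have "edges D = ?E" by (intro equalityI subsetI) auto
  with distinct V show thesis by (intro that) (simp only: double_star_labelling_def)
qed

lemma double_star_labelling_vdegree:
  assumes "double_star_labelling D u v x\<^sub>1 x\<^sub>2 y\<^sub>1 y\<^sub>2"
  shows "vdegree D u = 3" "vdegree D v = 3" "\<And>x. x \<in> {x\<^sub>1, x\<^sub>2, y\<^sub>1, y\<^sub>2} \<Longrightarrow> vdegree D x = 1"
proof -
  note distinct = double_star_labellingD(1)[OF assms] and V = double_star_labellingD(2)[OF assms]
    and E = double_star_labellingD(3)[OF assms]
  have D: "simple_graph D" unfolding simple_graph_def E V using distinct by auto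
  have "neighbours D u = {v, x\<^sub>1, x\<^sub>2}" "neighbours D v = {u, y\<^sub>1, y\<^sub>2}"
    "neighbours D x\<^sub>1 = {u}" "neighbours D x\<^sub>2 = {u}" "neighbours D y\<^sub>1 = {v}" "neighbours D y\<^sub>2 = {v}"
    unfolding neighbours_def E using distinct by (auto simp: doubleton_eq_iff)
  then show "vdegree D u = 3" "vdegree D v = 3" "\<And>x. x \<in> {x\<^sub>1, x\<^sub>2, y\<^sub>1, y\<^sub>2} \<Longrightarrow> vdegree D x = 1"
    using distinct by (auto simp: vdegree_eq_card_neighbours[OF D])
qed

lemma double_star_labelling_leaves:
  assumes "double_star_labelling D u v x\<^sub>1 x\<^sub>2 y\<^sub>1 y\<^sub>2"
  shows "leaves D = {x\<^sub>1, x\<^sub>2, y\<^sub>1, y\<^sub>2}"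
proof -
  have "verts D = {u, v} \<union> {x\<^sub>1, x\<^sub>2, y\<^sub>1, y\<^sub>2}" unfolding double_star_labellingD(2)[OF assms] by blast
  then show ?thesis using double_star_labelling_vdegree[OF assms] unfolding leaves_def by auto
qed

lemma vdegree_double_star:
  assumes "double_star D" "v \<in> verts D"
  shows "vdegree D v = 1 \<or> vdegree D v = 3"
proof -
  obtain a b x\<^sub>1 x\<^sub>2 y\<^sub>1 y\<^sub>2 where labelling: "double_star_labelling D a b x\<^sub>1 x\<^sub>2 y\<^sub>1 y\<^sub>2"
    using assms(1) by (rule ex_double_star_labelling)
  have "v = a \<or> v = b \<or> v \<in> {x\<^sub>1, x\<^sub>2, y\<^sub>1, y\<^sub>2}"
    using assms(2) unfolding double_star_labellingD(2)[OF labelling] by simp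
  then show ?thesis
    using double_star_labelling_vdegree(1,2)[OF labelling]
      double_star_labelling_vdegree(3)[OF labelling, of v]
    by (elim disjE) simp_all
qed

section \<open>Colouring double-stars\<close>

text \<open>The demands on the pair of colours of an edge with list \<open>X\<close> ending in a late leaf: it must meet
  the members of \<open>\<F>\<close>, one of which contains the colour \<open>c\<close> prescribed for the leaf.\<close>

definition demand_family :: "'c set \<Rightarrow> 'c \<Rightarrow> 'c set set \<Rightarrow> bool" where
  "demand_family X c \<F> \<longleftrightarrow>
     finite \<F> \<and> card \<F> \<le> 2 \<and> \<Union>\<F> \<subseteq> X \<and> (\<forall>F\<in>\<F>. 2 \<le> card F) \<and> c \<in> \<Union>\<F>"

lemma ex_subset_meeting_demands:
  assumes "demand_family X c \<F>"
  shows "\<exists>P\<subseteq>X. card P \<le> 2 \<and> s \<notin> P \<and> c \<in> insert s P \<and> (\<forall>F\<in>\<F>. P \<inter> F \<noteq> {})"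
proof -
  have "finite \<F>" "card \<F> \<le> 2" "\<Union>\<F> \<subseteq> X" "c \<in> \<Union>\<F>" and two: "\<And>F. F \<in> \<F> \<Longrightarrow> 2 \<le> card F"
    using assms unfolding demand_family_def by blast+
  obtain P where P: "P \<subseteq> \<Union>\<F>" "card P \<le> card \<F>" "s \<notin> P" "c \<in> insert s P" "\<forall>F\<in>\<F>. P \<inter> F \<noteq> {}"
    using ex_hitting_set_avoiding[OF \<open>finite \<F>\<close> two \<open>c \<in> \<Union>\<F>\<close>, of s] by blast
  moreover have "P \<subseteq> X" using P(1) \<open>\<Union>\<F> \<subseteq> X\<close> by (rule subset_trans)
  moreover have "card P \<le> 2" using P(2) \<open>card \<F> \<le> 2\<close> by (rule le_trans)
  ultimately show ?thesis by blast
qed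

lemma ex_compatible_demand_sets:
  assumes compatible: "compatible K c d" and demands: "demand_family X c \<F>" "demand_family Y d \<G>"
    and fin: "finite X" "finite Y"
  obtains P Q where "P \<subseteq> X" "card P \<le> 2" "s \<notin> P" "\<forall>F\<in>\<F>. P \<inter> F \<noteq> {}"
    "Q \<subseteq> Y" "card Q \<le> 2" "t \<notin> Q" "\<forall>F\<in>\<G>. Q \<inter> F \<noteq> {}"
    "card (K \<inter> (insert s P \<union> insert t Q)) \<le> 5"
proof -
  obtain P where P: "P \<subseteq> X" "card P \<le> 2" "s \<notin> P" "c \<in> insert s P" "\<forall>F\<in>\<F>. P \<inter> F \<noteq> {}"
    using ex_subset_meeting_demands[OF demands(1), of s] by blast
  obtain Q where Q: "Q \<subseteq> Y" "card Q \<le> 2" "t \<notin> Q" "d \<in> insert t Q" "\<forall>F\<in>\<G>. Q \<inter> F \<noteq> {}"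
    using ex_subset_meeting_demands[OF demands(2), of t] by blast
  have finite_PQ: "finite P" "finite Q" using P(1) Q(1) fin finite_subset by blast+
  then have "card (K \<inter> (insert s P \<union> insert t Q)) < card (insert s P) + card (insert t Q)"
    using P(4) Q(4) compatible by (intro card_Int_Un_less_if_compatible) simp_all
  also have "\<dots> \<le> 6" using finite_PQ P(2,3) Q(2,3) by simp
  finally show thesis using that[OF P(1-3,5) Q(1-3,5)] by simp
qed

text \<open>The pendant edges of the two halves have lists \<open>X\<^sub>1\<close>, \<open>X\<^sub>2\<close> and \<open>Y\<^sub>1\<close>, \<open>Y\<^sub>2\<close>, the late leaves being
  at \<open>X\<^sub>2\<close> and \<open>Y\<^sub>2\<close>, and \<open>K\<close> is the list of the central edge. As \<open>c\<close> and \<open>d\<close> are compatible, the at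
  most six colours forced by the leaves include at most five of \<open>K\<close>, and the pairs are completed
  without using up another one.\<close>

lemma ex_double_star_colours:
  assumes "7 \<le> n"
    and card: "card X\<^sub>1 = n" "card X\<^sub>2 = n" "card Y\<^sub>1 = n" "card Y\<^sub>2 = n" "card K = n"
    and compatible: "compatible K c d" and st: "s \<in> X\<^sub>1" "t \<in> Y\<^sub>1"
    and demands: "demand_family X\<^sub>2 c \<F>" "demand_family Y\<^sub>2 d \<G>"
  obtains f\<^sub>1 f\<^sub>2 g\<^sub>1 g\<^sub>2 k where
    "f\<^sub>1 \<subseteq> X\<^sub>1" "f\<^sub>2 \<subseteq> X\<^sub>2" "g\<^sub>1 \<subseteq> Y\<^sub>1" "g\<^sub>2 \<subseteq> Y\<^sub>2" "k \<subseteq> K"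
    "card f\<^sub>1 = 2" "card f\<^sub>2 = 2" "card g\<^sub>1 = 2" "card g\<^sub>2 = 2" "card k = 2"
    "f\<^sub>1 \<inter> f\<^sub>2 = {}" "g\<^sub>1 \<inter> g\<^sub>2 = {}" "k \<inter> (f\<^sub>1 \<union> f\<^sub>2 \<union> g\<^sub>1 \<union> g\<^sub>2) = {}"
    "s \<in> f\<^sub>1" "t \<in> g\<^sub>1" "\<forall>F\<in>\<F>. f\<^sub>2 \<inter> F \<noteq> {}" "\<forall>F\<in>\<G>. g\<^sub>2 \<inter> F \<noteq> {}"
proof -
  have fin: "finite X\<^sub>2" "finite Y\<^sub>2" "finite K"
    using card \<open>7 \<le> n\<close> by (auto intro: card_ge_0_finite)
  obtain P Q where P: "P \<subseteq> X\<^sub>2" "card P \<le> 2" "s \<notin> P" and meets_P: "\<forall>F\<in>\<F>. P \<inter> F \<noteq> {}"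
    and Q: "Q \<subseteq> Y\<^sub>2" "card Q \<le> 2" "t \<notin> Q" and meets_Q: "\<forall>F\<in>\<G>. Q \<inter> F \<noteq> {}"
    and "card (K \<inter> (insert s P \<union> insert t Q)) \<le> 5"
    using compatible demands fin(1,2) by (rule ex_compatible_demand_sets)
  define W where "W = insert s P \<union> insert t Q"
  then have W: "card (K \<inter> W) \<le> 5" using \<open>card (K \<inter> (insert s P \<union> insert t Q)) \<le> 5\<close> by simp
  have sub_W: "insert s P \<subseteq> W" unfolding W_def by blast
  obtain f\<^sub>1 f\<^sub>2 where f: "f\<^sub>1 \<subseteq> X\<^sub>1" "card f\<^sub>1 = 2" "s \<in> f\<^sub>1" "f\<^sub>2 \<subseteq> X\<^sub>2" "card f\<^sub>2 = 2" "P \<subseteq> f\<^sub>2"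
      "f\<^sub>1 \<inter> f\<^sub>2 = {}"
    and Wf: "card (K \<inter> (W \<union> f\<^sub>1 \<union> f\<^sub>2)) \<le> 5"
    using ex_disjoint_pairs_card_Int_le[OF fin(3) _ _ _ _ st(1) P(1,3,2) sub_W W] card \<open>7 \<le> n\<close> by auto
  have sub_Wf: "insert t Q \<subseteq> W \<union> f\<^sub>1 \<union> f\<^sub>2" unfolding W_def by blast
  obtain g\<^sub>1 g\<^sub>2 where g: "g\<^sub>1 \<subseteq> Y\<^sub>1" "card g\<^sub>1 = 2" "t \<in> g\<^sub>1" "g\<^sub>2 \<subseteq> Y\<^sub>2" "card g\<^sub>2 = 2" "Q \<subseteq> g\<^sub>2"
      "g\<^sub>1 \<inter> g\<^sub>2 = {}"
    and Wg: "card (K \<inter> (W \<union> f\<^sub>1 \<union> f\<^sub>2 \<union> g\<^sub>1 \<union> g\<^sub>2)) \<le> 5"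
    using ex_disjoint_pairs_card_Int_le[OF fin(3) _ _ _ _ st(2) Q(1,3,2) sub_Wf Wf] card \<open>7 \<le> n\<close> by auto
  have "2 \<le> card (K - (W \<union> f\<^sub>1 \<union> f\<^sub>2 \<union> g\<^sub>1 \<union> g\<^sub>2))"
    using Wg card(5) fin(3) \<open>7 \<le> n\<close> by (simp add: card_Diff_subset_Int)
  then obtain k where k: "k \<subseteq> K - (W \<union> f\<^sub>1 \<union> f\<^sub>2 \<union> g\<^sub>1 \<union> g\<^sub>2)" "card k = 2"
    by (meson obtain_subset_with_card_n)
  have "\<forall>F\<in>\<F>. f\<^sub>2 \<inter> F \<noteq> {}" using meets_P f(6) by blast
  moreover have "\<forall>F\<in>\<G>. g\<^sub>2 \<inter> F \<noteq> {}" using meets_Q g(6) by blast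
  moreover have "k \<subseteq> K" "k \<inter> (f\<^sub>1 \<union> f\<^sub>2 \<union> g\<^sub>1 \<union> g\<^sub>2) = {}" using k(1) by blast+
  ultimately show thesis using that[of f\<^sub>1 f\<^sub>2 g\<^sub>1 g\<^sub>2 k] f g k(2) by simp
qed

text \<open>The partial map \<open>r\<close> marks one leaf in each half as late and prescribes colours for the two late
  leaves that cost the central edge at most one colour.\<close>

definition late_marking :: "('a set \<Rightarrow> 'c set) \<Rightarrow> 'a graph \<Rightarrow> ('a \<rightharpoonup> 'c) \<Rightarrow> bool" where
  "late_marking L D r \<longleftrightarrow>
     (\<exists>u v x\<^sub>1 x\<^sub>2 y\<^sub>1 y\<^sub>2 c d. double_star_labelling D u v x\<^sub>1 x\<^sub>2 y\<^sub>1 y\<^sub>2 \<and>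
        r |` verts D = [x\<^sub>2 \<mapsto> c, y\<^sub>2 \<mapsto> d] \<and>
        c \<in> L {u, x\<^sub>2} \<and> d \<in> L {v, y\<^sub>2} \<and> compatible (L {u, v}) c d)"

lemma ex_late_marking:
  assumes "double_star D" "0 < m" and card_L: "\<And>e. e \<in> edges D \<Longrightarrow> card (L e) = m"
  shows "\<exists>r. late_marking L D r"
proof -
  obtain u v x\<^sub>1 x\<^sub>2 y\<^sub>1 y\<^sub>2 where labelling: "double_star_labelling D u v x\<^sub>1 x\<^sub>2 y\<^sub>1 y\<^sub>2"
    using \<open>double_star D\<close> by (rule ex_double_star_labelling)
  have card: "card (L {u, x\<^sub>2}) = m" "card (L {v, y\<^sub>2}) = m" "card (L {u, v}) = m"
    using card_L unfolding double_star_labellingD(3)[OF labelling] by simp_all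
  then obtain d where d: "d \<in> L {v, y\<^sub>2}" using \<open>0 < m\<close> by fastforce
  obtain c where c: "c \<in> L {u, x\<^sub>2}" "compatible (L {u, v}) c d"
    using ex_compatible[of "L {u, v}" "L {u, x\<^sub>2}" d] card \<open>0 < m\<close> by (force intro: card_ge_0_finite)
  have "[x\<^sub>2 \<mapsto> c, y\<^sub>2 \<mapsto> d] |` verts D = [x\<^sub>2 \<mapsto> c, y\<^sub>2 \<mapsto> d]"
    unfolding double_star_labellingD(2)[OF labelling] by (auto simp: restrict_map_def)
  then show ?thesis using labelling c d unfolding late_marking_def by blast
qed

lemma late_marking_cong:
  assumes "late_marking L D r" "\<And>v. v \<in> verts D \<Longrightarrow> r v = r' v"
  shows "late_marking L D r'"
proof -
  have "r |` verts D = r' |` verts D" using assms(2) by (auto simp: restrict_map_def)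
  then show ?thesis using assms(1) unfolding late_marking_def by simp
qed

lemma double_star_labelling_pendant_edge:
  assumes "double_star_labelling D u v x\<^sub>1 x\<^sub>2 y\<^sub>1 y\<^sub>2" "e \<in> edges D"
  shows "x\<^sub>1 \<in> e \<Longrightarrow> e = {u, x\<^sub>1}" "x\<^sub>2 \<in> e \<Longrightarrow> e = {u, x\<^sub>2}"
    "y\<^sub>1 \<in> e \<Longrightarrow> e = {v, y\<^sub>1}" "y\<^sub>2 \<in> e \<Longrightarrow> e = {v, y\<^sub>2}"
proof -
  note distinct = double_star_labellingD(1)[OF assms(1)]
  have "e = {u, v} \<or> e = {u, x\<^sub>1} \<or> e = {u, x\<^sub>2} \<or> e = {v, y\<^sub>1} \<or> e = {v, y\<^sub>2}"
    using assms(2) unfolding double_star_labellingD(3)[OF assms(1)] by simp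
  with distinct show "x\<^sub>1 \<in> e \<Longrightarrow> e = {u, x\<^sub>1}" "x\<^sub>2 \<in> e \<Longrightarrow> e = {u, x\<^sub>2}"
    "y\<^sub>1 \<in> e \<Longrightarrow> e = {v, y\<^sub>1}" "y\<^sub>2 \<in> e \<Longrightarrow> e = {v, y\<^sub>2}"
    by (elim disjE; auto)+
qed

lemma late_marking_leaf:
  assumes "late_marking L D r" "x \<in> verts D" "r x = Some c"
  shows "x \<in> leaves D" "e \<in> edges D \<Longrightarrow> x \<in> e \<Longrightarrow> c \<in> L e"
proof -
  obtain u v x\<^sub>1 x\<^sub>2 y\<^sub>1 y\<^sub>2 a b where labelling: "double_star_labelling D u v x\<^sub>1 x\<^sub>2 y\<^sub>1 y\<^sub>2"
    and r: "r |` verts D = [x\<^sub>2 \<mapsto> a, y\<^sub>2 \<mapsto> b]" and ab: "a \<in> L {u, x\<^sub>2}" "b \<in> L {v, y\<^sub>2}"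
    using assms(1) unfolding late_marking_def by blast
  have "[x\<^sub>2 \<mapsto> a, y\<^sub>2 \<mapsto> b] x = Some c" unfolding r[symmetric] using assms(2,3) by simp
  then have x: "x = x\<^sub>2 \<and> c = a \<or> x = y\<^sub>2 \<and> c = b" by (auto split: if_splits)
  then show "x \<in> leaves D" unfolding double_star_labelling_leaves[OF labelling] by blast
  show "c \<in> L e" if "e \<in> edges D" "x \<in> e"
    using x ab that double_star_labelling_pendant_edge[OF labelling that(1)] by metis
qed

definition serves_leaf ::
    "('a \<rightharpoonup> 'c) \<Rightarrow> ('a \<Rightarrow> 'c) \<Rightarrow> ('a \<Rightarrow> 'c set set) \<Rightarrow> 'a \<Rightarrow> 'c set \<Rightarrow> bool" where
  "serves_leaf r \<sigma> \<F> x A \<longleftrightarrow> (if r x = None then \<sigma> x \<in> A else \<forall>F\<in>\<F> x. A \<inter> F \<noteq> {})"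

lemma ex_double_star_edge_colouring:
  fixes L :: "'a set \<Rightarrow> 'c set"
  assumes marking: "late_marking L D r"
    and "7 \<le> n" and card_L: "\<And>e. e \<in> edges D \<Longrightarrow> card (L e) = n"
    and early: "\<And>x e. x \<in> leaves D \<Longrightarrow> e \<in> edges D \<Longrightarrow> x \<in> e \<Longrightarrow> r x = None \<Longrightarrow> \<sigma> x \<in> L e"
    and late: "\<And>x e c. x \<in> leaves D \<Longrightarrow> e \<in> edges D \<Longrightarrow> x \<in> e \<Longrightarrow> r x = Some c \<Longrightarrow>
      demand_family (L e) c (\<F> x)"
  shows "\<exists>f. list_edge_colouring L 2 (edges D) f \<and>
    (\<forall>e\<in>edges D. \<forall>x\<in>e \<inter> leaves D. serves_leaf r \<sigma> \<F> x (f e))"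
proof -
  obtain u v x\<^sub>1 x\<^sub>2 y\<^sub>1 y\<^sub>2 c d where labelling: "double_star_labelling D u v x\<^sub>1 x\<^sub>2 y\<^sub>1 y\<^sub>2"
    and rD: "r |` verts D = [x\<^sub>2 \<mapsto> c, y\<^sub>2 \<mapsto> d]" and compatible: "compatible (L {u, v}) c d"
    using marking unfolding late_marking_def by blast
  note distinct = double_star_labellingD(1)[OF labelling] and E = double_star_labellingD(3)[OF labelling]
    and leaves = double_star_labelling_leaves[OF labelling]
  have "r x = [x\<^sub>2 \<mapsto> c, y\<^sub>2 \<mapsto> d] x" if "x \<in> leaves D" for x
    unfolding rD[symmetric] using that by (simp add: leaves_def)
  then have r_leaf: "r x\<^sub>1 = None" "r x\<^sub>2 = Some c" "r y\<^sub>1 = None" "r y\<^sub>2 = Some d"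
    using distinct by (auto simp: leaves)
  have card: "card (L {u, x\<^sub>1}) = n" "card (L {u, x\<^sub>2}) = n" "card (L {v, y\<^sub>1}) = n"
    "card (L {v, y\<^sub>2}) = n" "card (L {u, v}) = n"
    using card_L unfolding E by simp_all
  have slots: "\<sigma> x\<^sub>1 \<in> L {u, x\<^sub>1}" "\<sigma> y\<^sub>1 \<in> L {v, y\<^sub>1}"
    using early r_leaf unfolding leaves E by simp_all
  have demands: "demand_family (L {u, x\<^sub>2}) c (\<F> x\<^sub>2)" "demand_family (L {v, y\<^sub>2}) d (\<F> y\<^sub>2)"
    using late r_leaf unfolding leaves E by simp_all
  obtain f\<^sub>1 f\<^sub>2 g\<^sub>1 g\<^sub>2 k where
    sub: "f\<^sub>1 \<subseteq> L {u, x\<^sub>1}" "f\<^sub>2 \<subseteq> L {u, x\<^sub>2}" "g\<^sub>1 \<subseteq> L {v, y\<^sub>1}" "g\<^sub>2 \<subseteq> L {v, y\<^sub>2}" "k \<subseteq> L {u, v}"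
    and two: "card f\<^sub>1 = 2" "card f\<^sub>2 = 2" "card g\<^sub>1 = 2" "card g\<^sub>2 = 2" "card k = 2"
    and disj: "f\<^sub>1 \<inter> f\<^sub>2 = {}" "g\<^sub>1 \<inter> g\<^sub>2 = {}" "k \<inter> (f\<^sub>1 \<union> f\<^sub>2 \<union> g\<^sub>1 \<union> g\<^sub>2) = {}"
    and served: "\<sigma> x\<^sub>1 \<in> f\<^sub>1" "\<sigma> y\<^sub>1 \<in> g\<^sub>1" "\<forall>F\<in>\<F> x\<^sub>2. f\<^sub>2 \<inter> F \<noteq> {}" "\<forall>F\<in>\<F> y\<^sub>2. g\<^sub>2 \<inter> F \<noteq> {}"
    by (rule ex_double_star_colours[OF \<open>7 \<le> n\<close> card compatible slots demands])
  define f where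
    "f = (\<lambda>_. {})({u, v} := k, {u, x\<^sub>1} := f\<^sub>1, {u, x\<^sub>2} := f\<^sub>2, {v, y\<^sub>1} := g\<^sub>1, {v, y\<^sub>2} := g\<^sub>2)"
  have f: "f {u, v} = k" "f {u, x\<^sub>1} = f\<^sub>1" "f {u, x\<^sub>2} = f\<^sub>2" "f {v, y\<^sub>1} = g\<^sub>1" "f {v, y\<^sub>2} = g\<^sub>2"
    unfolding f_def using distinct by (auto simp: doubleton_eq_iff)
  have "list_edge_colouring L 2 (edges D) f"
    unfolding list_edge_colouring_def E using f sub two disj distinct by auto
  moreover have "serves_leaf r \<sigma> \<F> x (f e)" if "e \<in> edges D" "x \<in> e \<inter> leaves D" for e x
    using that(2) double_star_labelling_pendant_edge[OF labelling that(1)] f served r_leaf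
    unfolding leaves serves_leaf_def by auto
  ultimately show ?thesis by blast
qed

lemma ex_double_stars_edge_colouring:
  fixes L :: "'a set \<Rightarrow> 'c set"
  assumes simple: "simple_graph H"
    and marking: "\<And>D. D \<in> graph_components H \<Longrightarrow> late_marking L D r"
    and "7 \<le> n" and card_L: "\<And>e. e \<in> edges H \<Longrightarrow> card (L e) = n"
    and early: "\<And>x e. x \<in> leaves H \<Longrightarrow> e \<in> edges H \<Longrightarrow> x \<in> e \<Longrightarrow> r x = None \<Longrightarrow> \<sigma> x \<in> L e"
    and late: "\<And>x e c. x \<in> leaves H \<Longrightarrow> e \<in> edges H \<Longrightarrow> x \<in> e \<Longrightarrow> r x = Some c \<Longrightarrow>
      demand_family (L e) c (\<F> x)"
  shows "\<exists>f. list_edge_colouring L 2 (edges H) f \<and>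
    (\<forall>e\<in>edges H. \<forall>x\<in>e \<inter> leaves H. serves_leaf r \<sigma> \<F> x (f e))"
proof -
  let ?P = "\<lambda>D f. list_edge_colouring L 2 (edges D) f \<and>
    (\<forall>e\<in>edges D. \<forall>x\<in>e \<inter> leaves D. serves_leaf r \<sigma> \<F> x (f e))"
  have "\<exists>f. \<forall>D\<in>graph_components H. ?P D f"
  proof (rule ex_glued_function[OF disjoint_edges_graph_components[OF simple]])
    fix D assume D: "D \<in> graph_components H"
    have "edges D \<subseteq> edges H" "leaves D \<subseteq> leaves H"
      using verts_edges_graph_components(2)[OF D] leaves_graph_component[OF simple D] by auto
    then show "\<exists>f. ?P D f"
      using card_L early late by (intro ex_double_star_edge_colouring[OF marking[OF D] \<open>7 \<le> n\<close>]) blast+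
    show "?P D g" if "\<And>e. e \<in> edges D \<Longrightarrow> f e = g e" "?P D f" for f g
      using that list_edge_colouring_cong[of L 2 "edges D" f g] by simp
  qed
  then obtain f where f: "\<forall>D\<in>graph_components H. ?P D f" by blast
  have "list_edge_colouring L 2 (edges H) f"
    using f by (intro list_edge_colouring_graph_components[OF simple]) blast
  moreover have "serves_leaf r \<sigma> \<F> x (f e)" if e: "e \<in> edges H" "x \<in> e \<inter> leaves H" for e x
  proof -
    note D = edge_mem_component[OF simple e(1) IntD1[OF e(2)]]
    then have "x \<in> leaves (component H x)"
      using verts_edges_graph_components(3)[OF D(1)] e leaves_graph_component[OF simple D(1)] by blast
    then show ?thesis using f D e(2) by blast
  qed
  ultimately show ?thesis by blast
qed

section \<open>MED decompositions of cubic graphs\<close>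

text \<open>\<open>M\<close> is the matching, \<open>C\<close> consists of the cycles and \<open>S\<close> of the double-stars.\<close>

locale cubic_MED_decomposition =
  fixes G M C S :: "'a graph"
  assumes simple_G: "simple_graph G" and cubic: "regular_graph 3 G"
    and MED: "MED_decomposition G M C S"
begin

lemma simple_parts: "simple_graph M" "simple_graph C" "simple_graph S"
  using MED unfolding MED_decomposition_def subgraph_def by blast+

lemma verts_parts: "verts M \<subseteq> verts G" "verts C \<subseteq> verts G" "verts S \<subseteq> verts G"
  using MED unfolding MED_decomposition_def subgraph_def by blast+

lemma edges_parts: "edges G = edges M \<union> edges S \<union> edges C"
  using MED unfolding MED_decomposition_def by blast

lemma edges_parts_disjoint:
  "edges M \<inter> edges C = {}" "edges M \<inter> edges S = {}" "edges C \<inter> edges S = {}"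
  using MED unfolding MED_decomposition_def by simp_all

lemma even_cycles: "K \<in> graph_components C \<Longrightarrow> even_cycle K"
  using MED unfolding MED_decomposition_def by blast

lemma double_stars: "D \<in> graph_components S \<Longrightarrow> double_star D"
  using MED unfolding MED_decomposition_def independent_double_stars_def by blast

lemma independent_leaves: "independent_set G (leaves S)"
  using MED unfolding MED_decomposition_def independent_double_stars_def
  by (simp add: leaves_eq_Union_graph_components[OF simple_parts(3)])

lemmas finite_edges_G = simple_graph_finite_edges[OF simple_G]

lemma card_spokes_vdegree:
  "card {e \<in> edges M \<union> edges S. v \<in> e} = vdegree M v + vdegree S v"
proof -
  have "{e \<in> edges M \<union> edges S. v \<in> e} = {e \<in> edges M. v \<in> e} \<union> {e \<in> edges S. v \<in> e}" by blast
  then show ?thesis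
    using finite_edges_G edges_parts_disjoint(2) unfolding vdegree_def edges_parts
    by (simp add: card_Un_disjoint disjoint_iff)
qed

lemma vdegree_parts:
  assumes "v \<in> verts G"
  shows "vdegree M v + vdegree S v + vdegree C v = 3"
proof -
  have "{e \<in> edges G. v \<in> e} = {e \<in> edges M \<union> edges S. v \<in> e} \<union> {e \<in> edges C. v \<in> e}"
    unfolding edges_parts by blast
  moreover have "card ({e \<in> edges M \<union> edges S. v \<in> e} \<union> {e \<in> edges C. v \<in> e})
      = card {e \<in> edges M \<union> edges S. v \<in> e} + card {e \<in> edges C. v \<in> e}"
    using finite_edges_G edges_parts_disjoint unfolding edges_parts by (intro card_Un_disjoint) auto
  moreover have "vdegree G v = 3" using cubic assms unfolding regular_graph_def by blast
  ultimately show ?thesis using card_spokes_vdegree[of v] unfolding vdegree_def by simp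
qed

lemma matching_edge_eq: "e \<in> edges M \<Longrightarrow> e' \<in> edges M \<Longrightarrow> v \<in> e \<Longrightarrow> v \<in> e' \<Longrightarrow> e = e'"
  using MED unfolding MED_decomposition_def is_matching_def by blast

lemma vdegree_M_le_1: "vdegree M v \<le> 1"
proof -
  have "finite {e \<in> edges M. v \<in> e}" using finite_edges_G unfolding edges_parts by simp
  then show ?thesis
    using matching_edge_eq[of _ _ v] unfolding vdegree_def by (simp add: card_le_Suc0_iff_eq)
qed

lemma card_neighbours_C:
  assumes "v \<in> verts C"
  shows "card (neighbours C v) = 2"
proof -
  note K = component_in_graph_components[OF assms] mem_verts_component_self[OF assms]
  have "is_cycle (component C v)" using even_cycles[OF K(1)] unfolding even_cycle_def by blast
  from card_neighbours_cycle[OF this K(2)] show ?thesis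
    by (simp add: neighbours_graph_component[OF simple_parts(2) K])
qed

lemma vdegree_C: "vdegree C v = (if v \<in> verts C then 2 else 0)"
  using card_neighbours_C vdegree_eq_0_if_notin_verts[OF simple_parts(2)]
  by (simp add: vdegree_eq_card_neighbours[OF simple_parts(2)])

lemma vdegree_S_cases: "vdegree S v \<in> {0, 1, 3}"
proof (cases "v \<in> verts S")
  case True
  note D = component_in_graph_components[OF True] mem_verts_component_self[OF True]
  show ?thesis
    using vdegree_double_star[OF double_stars[OF D(1)] D(2)]
      vdegree_graph_component[OF simple_parts(3) D] by auto
qed (simp add: vdegree_eq_0_if_notin_verts simple_parts)

lemma matching_edge_subset_C:
  assumes "e \<in> edges M"
  shows "e \<subseteq> verts C"
proof
  fix v assume v: "v \<in> e"
  then have "v \<in> verts G" using assms simple_parts(1) verts_parts(1) unfolding simple_graph_def by blast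
  moreover have "vdegree M v \<noteq> 0"
    using assms v finite_edges_G unfolding vdegree_def edges_parts by auto
  ultimately show "v \<in> verts C"
    using vdegree_parts[of v] vdegree_M_le_1[of v] vdegree_S_cases[of v] vdegree_C[of v]
    by (auto split: if_splits)
qed

lemma leaves_subset_C: "leaves S \<subseteq> verts C"
proof
  fix v assume "v \<in> leaves S"
  then have "v \<in> verts G" "vdegree S v = 1" using verts_parts(3) unfolding leaves_def by auto
  then show "v \<in> verts C"
    using vdegree_parts[of v] vdegree_M_le_1[of v] vdegree_C[of v] by (simp split: if_splits)
qed

text \<open>Only meaningful for cycle vertices.\<close>

definition spoke :: "'a \<Rightarrow> 'a set" where
  "spoke v = (THE e. e \<in> edges M \<union> edges S \<and> v \<in> e)"

lemma spoke_iff: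
  assumes "v \<in> verts C"
  shows "e \<in> edges M \<union> edges S \<and> v \<in> e \<longleftrightarrow> e = spoke v"
proof -
  have "v \<in> verts G" using assms verts_parts(2) by blast
  then have "card {e \<in> edges M \<union> edges S. v \<in> e} = 1"
    using vdegree_parts[of v] vdegree_C[of v] assms card_spokes_vdegree[of v] by simp
  then obtain a where "{e \<in> edges M \<union> edges S. v \<in> e} = {a}" by (rule card_1_singletonE)
  then have a: "e \<in> edges M \<union> edges S \<and> v \<in> e \<longleftrightarrow> e = a" for e by blast
  then have "spoke v = a" unfolding spoke_def by simp
  then show ?thesis using a by simp
qed

lemma spoke_in_edges:
  assumes "v \<in> verts C"
  shows "spoke v \<in> edges M \<union> edges S" "spoke v \<in> edges G" "v \<in> spoke v"
  using spoke_iff[OF assms, of "spoke v"] unfolding edges_parts by blast+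

lemma spoke_in_S_if_leaf:
  assumes "x \<in> leaves S"
  shows "spoke x \<in> edges S"
proof -
  obtain e where "e \<in> edges S" "x \<in> e"
    using assms unfolding leaves_def vdegree_def by (auto dest!: card_eq_SucD)
  then show ?thesis using spoke_iff[of x e] leaves_subset_C assms by blast
qed

lemma leaf_if_spoke_in_S:
  assumes v: "v \<in> verts C" and "spoke v \<in> edges S"
  shows "v \<in> leaves S"
proof -
  have "v \<in> verts S"
    using assms(2) spoke_in_edges(3)[OF v] simple_parts(3) unfolding simple_graph_def by blast
  moreover have "{e \<in> edges S. v \<in> e} = {spoke v}" using spoke_iff[OF v] assms(2) by blast
  ultimately show ?thesis unfolding leaves_def vdegree_def by simp
qed

lemma spoke_in_M_if_next_to_leaf:
  assumes x: "x \<in> leaves S" and w: "w \<in> neighbours C x"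
  shows "spoke w \<in> edges M" "w \<notin> leaves S"
proof -
  show "w \<notin> leaves S"
    using independent_leaves x w unfolding independent_set_def neighbours_def edges_parts by blast
  moreover have "w \<in> verts C" using neighbours_in_verts(2)[OF simple_parts(2) w] .
  ultimately show "spoke w \<in> edges M" using leaf_if_spoke_in_S spoke_in_edges(1) by blast
qed

end

locale cubic_MED_lists = cubic_MED_decomposition G M C S
  for G M C S :: "'a graph" +
  fixes L :: "'a set \<Rightarrow> 'c set"
  assumes card_L: "e \<in> edges G \<Longrightarrow> card (L e) = 7"
begin

lemma finite_L: "e \<in> edges G \<Longrightarrow> finite (L e)"
  using card_L by (simp add: card_ge_0_finite)

lemma ex_late_markings:
  obtains r where "dom r \<subseteq> leaves S" "\<And>D. D \<in> graph_components S \<Longrightarrow> late_marking L D r"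
proof -
  have "\<exists>r. \<forall>D\<in>graph_components S. late_marking L D r"
  proof (rule ex_glued_function[OF disjoint_verts_graph_components])
    fix D assume D: "D \<in> graph_components S"
    then have "edges D \<subseteq> edges G" using verts_edges_graph_components(2)[OF D] edges_parts by blast
    then show "\<exists>r. late_marking L D r"
      using card_L by (intro ex_late_marking[OF double_stars[OF D], of 7]) auto
  qed (rule late_marking_cong)
  then obtain r where r: "\<forall>D\<in>graph_components S. late_marking L D r" by blast
  have "late_marking L D (r |` verts S)" if D: "D \<in> graph_components S" for D
    using verts_edges_graph_components(1)[OF D] r D
    by (intro late_marking_cong[of L D r "r |` verts S"]) (auto simp: restrict_map_def)
  moreover have "dom (r |` verts S) \<subseteq> leaves S"
  proof
    fix x assume "x \<in> dom (r |` verts S)"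
    then obtain c where x: "x \<in> verts S" "r x = Some c" by auto
    note D = component_in_graph_components[OF x(1)] mem_verts_component_self[OF x(1)]
    have "x \<in> leaves (component S x)" using r D x(2) by (blast intro: late_marking_leaf(1))
    then show "x \<in> leaves S" using leaves_graph_component[OF simple_parts(3) D(1)] by blast
  qed
  ultimately show thesis using that by blast
qed

lemma ex_assignment:
  assumes dom: "dom r \<subseteq> leaves S" and marking: "\<And>D. D \<in> graph_components S \<Longrightarrow> late_marking L D r"
  shows "\<exists>\<sigma>. compatible_assignment (\<lambda>v. L (spoke v)) L r C \<sigma>"
proof (rule ex_compatible_assignment_cycles[OF simple_parts(2), of 7])
  show "c \<in> L (spoke x)" if "x \<in> verts C" "r x = Some c" for x c
  proof -
    have x: "x \<in> leaves S" using dom that(2) by blast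
    note D = edge_mem_component[OF simple_parts(3) spoke_in_S_if_leaf[OF x] spoke_in_edges(3)[OF that(1)]]
    have "x \<in> verts (component S x)" using x unfolding leaves_def by (simp add: mem_verts_component_self)
    from late_marking_leaf(2)[OF marking[OF D(1)] this that(2) D(2)] show ?thesis
      using spoke_in_edges(3)[OF that(1)] .
  qed
  show "r w = None" if "w \<in> neighbours C v" "r v \<noteq> None" for v w
    using spoke_in_M_if_next_to_leaf(2)[OF _ that(1)] that(2) dom by blast
qed (use even_cycles card_L spoke_in_edges(2) edges_parts in \<open>auto simp: even_cycle_def\<close>)

lemma ex_matching_colouring:
  assumes \<sigma>: "\<And>v. v \<in> verts C \<Longrightarrow> \<sigma> v \<in> L (spoke v)"
  obtains f where "list_edge_colouring L 2 (edges M) f" "\<And>e v. e \<in> edges M \<Longrightarrow> v \<in> e \<Longrightarrow> \<sigma> v \<in> f e"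
proof -
  have "\<exists>P. \<sigma> ` e \<subseteq> P \<and> P \<subseteq> L e \<and> card P = 2" if e: "e \<in> edges M" for e
  proof (rule exists_subset_between)
    have "card e = 2" using simple_parts(1) e unfolding simple_graph_def by blast
    then show "card (\<sigma> ` e) \<le> 2" using card_image_le[of e \<sigma>] by (simp add: card_ge_0_finite)
    show "2 \<le> card (L e)" "finite (L e)" using e card_L finite_L edges_parts by auto
    have "e = spoke v" "v \<in> verts C" if "v \<in> e" for v
      using matching_edge_subset_C[OF e] spoke_iff[of v e] e that by blast+
    then show "\<sigma> ` e \<subseteq> L e" using \<sigma> by fastforce
  qed
  then obtain f where f: "\<And>e. e \<in> edges M \<Longrightarrow> \<sigma> ` e \<subseteq> f e \<and> f e \<subseteq> L e \<and> card (f e) = 2" by metis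
  have "list_edge_colouring L 2 (edges M) f"
    unfolding list_edge_colouring_def using f matching_edge_eq by blast
  then show thesis using that f by blast
qed

definition neighbour_demands :: "('a set \<Rightarrow> 'c set) \<Rightarrow> 'a \<Rightarrow> 'c set set" where
  "neighbour_demands f x =
     (\<lambda>w. L (spoke x) \<inter> compatible_with (L {x, w}) (f (spoke w))) ` neighbours C x"

lemma neighbour_demands_cong:
  assumes "x \<in> leaves S" "\<And>e. e \<in> edges M \<Longrightarrow> f e = g e"
  shows "neighbour_demands f x = neighbour_demands g x"
  unfolding neighbour_demands_def using assms spoke_in_M_if_next_to_leaf(1)
  by (intro image_cong) simp_all

lemma demand_family_neighbour_demands:
  assumes x: "x \<in> leaves S" "r x = Some c"
    and \<sigma>: "compatible_assignment (\<lambda>v. L (spoke v)) L r C \<sigma>"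
    and f: "list_edge_colouring L 2 (edges M) f" "\<And>e v. e \<in> edges M \<Longrightarrow> v \<in> e \<Longrightarrow> \<sigma> v \<in> f e"
  shows "demand_family (L (spoke x)) c (neighbour_demands f x)"
proof -
  have xC: "x \<in> verts C" using leaves_subset_C x(1) by blast
  note spoke_w = spoke_in_M_if_next_to_leaf(1)[OF x(1)]
  have card: "card (neighbours C x) = 2" using xC by (rule card_neighbours_C)
  then have fin: "finite (neighbours C x)" by (simp add: card_ge_0_finite)
  then have "finite (neighbour_demands f x)" unfolding neighbour_demands_def by (rule finite_imageI)
  moreover have "card (neighbour_demands f x) \<le> 2"
    unfolding neighbour_demands_def by (rule card_image_le[OF fin, unfolded card])
  moreover have "2 \<le> card (L (spoke x) \<inter> compatible_with (L {x, w}) (f (spoke w)))"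
    if w: "w \<in> neighbours C x" for w
  proof -
    have "{x, w} \<in> edges G" using w edges_parts unfolding neighbours_def by blast
    moreover have "card (f (spoke w)) = 2" using list_edge_colouringD(2)[OF f(1) spoke_w[OF w]] .
    ultimately show ?thesis
      using card_Int_compatible_with_ge[of "L {x, w}" "L (spoke x)" "f (spoke w)"]
        card_L finite_L spoke_in_edges(2)[OF xC] by simp
  qed
  moreover have "c \<in> \<Union> (neighbour_demands f x)"
  proof -
    obtain w where w: "w \<in> neighbours C x" "compatible (L {x, w}) c (\<sigma> w)" and "c \<in> L (spoke x)"
      using \<sigma> xC x(2) unfolding compatible_assignment_def by (metis option.distinct(1))
    moreover have "w \<in> verts C" using neighbours_in_verts(2)[OF simple_parts(2) w(1)] .
    then have "\<sigma> w \<in> f (spoke w)" using f(2)[OF spoke_w[OF w(1)]] spoke_in_edges(3) by blast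
    ultimately show ?thesis unfolding neighbour_demands_def compatible_with_def by blast
  qed
  ultimately show ?thesis unfolding demand_family_def neighbour_demands_def by blast
qed

definition spokes_compatible :: "('a set \<Rightarrow> 'c set) \<Rightarrow> bool" where
  "spokes_compatible f \<longleftrightarrow> (\<forall>v\<in>verts C. \<forall>w\<in>neighbours C v.
     \<exists>c\<in>f (spoke v). \<exists>d\<in>f (spoke w). compatible (L {v, w}) c d)"

lemma list_edge_colouring_spokes:
  assumes f: "list_edge_colouring L 2 (edges M) f" and g: "list_edge_colouring L 2 (edges S) g"
  shows "list_edge_colouring L 2 (edges M \<union> edges S) (override_on g f (edges M))"
proof (rule list_edge_colouring_Un[OF f g])
  fix e e' assume e: "e \<in> edges M" "e' \<in> edges S" "e \<inter> e' \<noteq> {}"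
  then obtain v where v: "v \<in> e" "v \<in> e'" by blast
  then have "e = spoke v" "e' = spoke v"
    using spoke_iff[of v] matching_edge_subset_C[OF e(1)] e(1,2) by blast+
  then show "f e \<inter> g e' = {}" using e(1,2) edges_parts_disjoint(2) by blast
qed

lemma assigned_colour_on_spoke:
  assumes matching: "\<And>e v. e \<in> edges M \<Longrightarrow> v \<in> e \<Longrightarrow> \<sigma> v \<in> f e"
    and served: "\<And>x. x \<in> leaves S \<Longrightarrow> serves_leaf r \<sigma> \<F> x (f (spoke x))"
    and v: "v \<in> verts C" "r v = None"
  shows "\<sigma> v \<in> f (spoke v)"
proof (cases "spoke v \<in> edges M")
  case True
  then show ?thesis using spoke_in_edges(3)[OF v(1)] by (rule matching)
next
  case False
  then have "v \<in> leaves S" using leaf_if_spoke_in_S[OF v(1)] spoke_in_edges(1)[OF v(1)] by blast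
  from served[OF this] show ?thesis using v(2) unfolding serves_leaf_def by simp
qed

lemma spokes_compatible_if_leaves_served:
  assumes dom: "dom r \<subseteq> leaves S"
    and \<sigma>: "compatible_assignment (\<lambda>v. L (spoke v)) L r C \<sigma>"
    and matching: "\<And>e v. e \<in> edges M \<Longrightarrow> v \<in> e \<Longrightarrow> \<sigma> v \<in> f e"
    and served: "\<And>x. x \<in> leaves S \<Longrightarrow> serves_leaf r \<sigma> (neighbour_demands f) x (f (spoke x))"
  shows "spokes_compatible f"
  unfolding spokes_compatible_def
proof (intro ballI)
  have late: "\<exists>c\<in>f (spoke v). \<exists>d\<in>f (spoke w). compatible (L {v, w}) c d"
    if "w \<in> neighbours C v" "r v \<noteq> None" for v w
  proof -
    have "v \<in> leaves S" using that(2) dom by blast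
    then have "f (spoke v) \<inter> compatible_with (L {v, w}) (f (spoke w)) \<noteq> {}"
      using served that unfolding serves_leaf_def neighbour_demands_def by fastforce
    then show ?thesis unfolding compatible_with_def by blast
  qed
  have early: "\<sigma> v \<in> f (spoke v)" if "v \<in> verts C" "r v = None" for v
    using matching served that by (rule assigned_colour_on_spoke)
  fix v w assume v: "v \<in> verts C" and w: "w \<in> neighbours C v"
  consider "r v \<noteq> None" | "r w \<noteq> None" | "r v = None" "r w = None" by blast
  then show "\<exists>c\<in>f (spoke v). \<exists>d\<in>f (spoke w). compatible (L {v, w}) c d"
  proof cases
    case 1
    then show ?thesis using late[OF w] by blast
  next
    case 2
    then have "\<exists>c\<in>f (spoke w). \<exists>d\<in>f (spoke v). compatible (L {w, v}) c d"
      using late w neighbours_commute by metis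
    then show ?thesis using compatible_commute by (metis insert_commute)
  next
    case 3
    then have "compatible (L {v, w}) (\<sigma> v) (\<sigma> w)"
      using \<sigma> v w unfolding compatible_assignment_def by blast
    then show ?thesis
      using early[OF v 3(1)] early[OF neighbours_in_verts(2)[OF simple_parts(2) w] 3(2)] by blast
  qed
qed

lemma ex_served_double_stars_colouring:
  assumes marking: "\<And>D. D \<in> graph_components S \<Longrightarrow> late_marking L D r"
    and \<sigma>: "compatible_assignment (\<lambda>v. L (spoke v)) L r C \<sigma>"
    and f: "list_edge_colouring L 2 (edges M) f" "\<And>e v. e \<in> edges M \<Longrightarrow> v \<in> e \<Longrightarrow> \<sigma> v \<in> f e"
  obtains g where "list_edge_colouring L 2 (edges S) g"
    "\<And>x. x \<in> leaves S \<Longrightarrow> serves_leaf r \<sigma> (neighbour_demands f) x (g (spoke x))"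
proof -
  have spoke_eq: "e = spoke x" if "x \<in> leaves S" "e \<in> edges S" "x \<in> e" for x e
    using spoke_iff[of x e] leaves_subset_C that by blast
  have "\<exists>g. list_edge_colouring L 2 (edges S) g \<and>
      (\<forall>e\<in>edges S. \<forall>x\<in>e \<inter> leaves S. serves_leaf r \<sigma> (neighbour_demands f) x (g e))"
  proof (rule ex_double_stars_edge_colouring[where n = 7, OF simple_parts(3) marking])
    show "card (L e) = 7" if "e \<in> edges S" for e using card_L that edges_parts by blast
    show "\<sigma> x \<in> L e" if "x \<in> leaves S" "e \<in> edges S" "x \<in> e" for x e
      using spoke_eq[OF that] \<sigma> leaves_subset_C that(1) unfolding compatible_assignment_def by blast
    show "demand_family (L e) c (neighbour_demands f x)"
      if "x \<in> leaves S" "e \<in> edges S" "x \<in> e" "r x = Some c" for x e c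
      using demand_family_neighbour_demands[OF that(1,4) \<sigma> f] spoke_eq[OF that(1-3)] by simp
  qed simp_all
  then obtain g where "list_edge_colouring L 2 (edges S) g"
    "\<forall>e\<in>edges S. \<forall>x\<in>e \<inter> leaves S. serves_leaf r \<sigma> (neighbour_demands f) x (g e)" by blast
  then show thesis using that spoke_in_S_if_leaf spoke_in_edges(3) leaves_subset_C by (meson IntI subsetD)
qed

lemma ex_spoke_colouring:
  obtains f where "list_edge_colouring L 2 (edges M \<union> edges S) f" "spokes_compatible f"
proof -
  obtain r where dom: "dom r \<subseteq> leaves S" and marking: "\<And>D. D \<in> graph_components S \<Longrightarrow> late_marking L D r"
    by (rule ex_late_markings) blast
  obtain \<sigma> where \<sigma>: "compatible_assignment (\<lambda>v. L (spoke v)) L r C \<sigma>"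
    using ex_assignment[OF dom marking] by blast
  then have "\<sigma> v \<in> L (spoke v)" if "v \<in> verts C" for v
    using that unfolding compatible_assignment_def by blast
  then obtain f where f: "list_edge_colouring L 2 (edges M) f" "\<And>e v. e \<in> edges M \<Longrightarrow> v \<in> e \<Longrightarrow> \<sigma> v \<in> f e"
    using ex_matching_colouring by metis
  obtain g where g: "list_edge_colouring L 2 (edges S) g"
    and served: "\<And>x. x \<in> leaves S \<Longrightarrow> serves_leaf r \<sigma> (neighbour_demands f) x (g (spoke x))"
    using ex_served_double_stars_colouring[OF marking \<sigma> f] by metis
  define h where "h = override_on g f (edges M)"
  have "spokes_compatible h"
  proof (rule spokes_compatible_if_leaves_served[OF dom \<sigma>])
    show "\<sigma> v \<in> h e" if "e \<in> edges M" "v \<in> e" for e v using f(2)[OF that] that(1) unfolding h_def by simp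
    fix x assume x: "x \<in> leaves S"
    have "h (spoke x) = g (spoke x)"
      using spoke_in_S_if_leaf[OF x] edges_parts_disjoint(2) unfolding h_def by (auto simp: override_on_def)
    moreover have "neighbour_demands h x = neighbour_demands f x"
      using x by (rule neighbour_demands_cong) (simp add: h_def)
    ultimately show "serves_leaf r \<sigma> (neighbour_demands h) x (h (spoke x))"
      using served[OF x] unfolding serves_leaf_def by simp
  qed
  then show thesis using list_edge_colouring_spokes[OF f(1) g] that unfolding h_def by blast
qed

lemma ex_list_edge_colouring: "\<exists>f. list_edge_colouring L 2 (edges G) f"
proof -
  obtain f where f: "list_edge_colouring L 2 (edges M \<union> edges S) f"
    and comp: "spokes_compatible f"
    by (rule ex_spoke_colouring)
  define B where "B e = L e - (\<Union>v\<in>e. f (spoke v))" for e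
  have "finite (B e) \<and> 2 * 2 \<le> card (B e)" if e: "e \<in> edges C" for e
  proof -
    have eG: "e \<in> edges G" using e edges_parts by blast
    obtain v where "v \<in> e" using simple_graph_edge_nonempty[OF simple_parts(2) e] .
    then obtain w where vw: "e = {v, w}" "v \<in> verts C" "w \<in> verts C" "w \<in> neighbours C v"
      using simple_graph_edgeE[OF simple_parts(2) e] by metis
    have card: "card (f (spoke u)) = 2" "finite (f (spoke u))" if "u \<in> verts C" for u
      using list_edge_colouringD(2)[OF f spoke_in_edges(1)[OF that]] by (simp_all add: card_ge_0_finite)
    obtain c d where "c \<in> f (spoke v)" "d \<in> f (spoke w)" "compatible (L e) c d"
      using comp vw unfolding spokes_compatible_def by blast
    then have "card (L e \<inter> (f (spoke v) \<union> f (spoke w))) < 4"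
      using card_Int_Un_less_if_compatible[of "f (spoke v)" "f (spoke w)" c d "L e"] card vw(2,3) by simp
    then show ?thesis
      using card_L[OF eG] finite_L[OF eG] unfolding B_def vw(1) by (simp add: card_Diff_subset_Int)
  qed
  then obtain g where g: "list_edge_colouring B 2 (edges C) g"
    using even_cycles_list_edge_colouring[OF simple_parts(2) even_cycles] by blast
  then have "list_edge_colouring L 2 (edges C) g"
    by (rule list_edge_colouring_mono) (auto simp: B_def)
  with f have "list_edge_colouring L 2 (edges M \<union> edges S \<union> edges C)
      (override_on g f (edges M \<union> edges S))"
  proof (rule list_edge_colouring_Un)
    fix e e' assume e: "e \<in> edges M \<union> edges S" "e' \<in> edges C" "e \<inter> e' \<noteq> {}"
    then obtain v where v: "v \<in> e" "v \<in> e'" by blast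
    then have "v \<in> verts C" using e(2) simple_parts(2) unfolding simple_graph_def by blast
    then have "e = spoke v" using spoke_iff e(1) v(1) by blast
    then show "f e \<inter> g e' = {}" using list_edge_colouringD(1)[OF g e(2)] v(2) unfolding B_def by blast
  qed
  then show ?thesis unfolding edges_parts by blast
qed

end

theorem theorem2:
  fixes G :: "'a graph"
  assumes "simple_graph G"
    and "regular_graph 3 G"
    and "\<exists>G1 G2 G3. MED_decomposition G G1 G2 G3"
  shows "edge_choosable TYPE('c) 7 2 G"
  unfolding edge_choosable_iff
proof (intro allI impI)
  fix L :: "'a set \<Rightarrow> 'c set"
  assume L: "\<forall>e\<in>edges G. finite (L e) \<and> card (L e) = 7"
  obtain G1 G2 G3 where "MED_decomposition G G1 G2 G3" using assms(3) by blast
  then interpret cubic_MED_lists G G1 G2 G3 L using assms(1,2) L by unfold_locales blast+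
  show "\<exists>f. list_edge_colouring L 2 (edges G) f" by (rule ex_list_edge_colouring)
qed

end
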